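(* Let $d\ge 2$ be an integer and $p\in[0,1)$. As $n\to\infty$, the arboreal gas measures $\mathbb{P}_{n,d,p}$ on the wired trees $T^{\mathsf w}_{n,d}$ converge weakly to a probability measure $\mathbb{P}_{d,p}$ on $\{0,1\}^{E(T_d)}$. Moreover $\mathbb{P}_{d,p}$ is a hidden tree-indexed Markov chain: it is the pushforward, under the map $\{0',1',2'\}^{E(T_d)}\to\{0,1\}^{E(T_d)}$ acting edge by edge by $0'\mapsto 0$, $1'\mapsto 1$, $2'\mapsto 1$, of the law of the $(\theta,\alpha)$-tree-indexed Markov process on $\{0',1',2'\}^{E(T_d)}$, with parameters $\theta=\frac{dp-1}{p(d-1)}$, $\alpha=\frac1d$ if $p\in(1/d,1)$, and $\theta=0$, $\alpha=p$ if $p\le 1/d$.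
   Context: Trees. $T_d$ is the infinite rooted tree with root $\rho$ in which every vertex has exactly $d$ children. $T_{n,d}$ is the rooted subtree of $T_d$ spanned by the vertices at distance at most $n$ from $\rho$ (so every non-leaf vertex has $d$ children and all leaves are at distance $n$). $T^{\mathsf w}_{n,d}$ is the (multi)graph obtained from $T_{n,d}$ by identifying all leaves into one vertex $\partial$; its edge set $E_{n,d}$ is identified with the edge set of $T_{n,d}$, a subset of $E(T_d)$. For an edge $e$, $e_-$ is its endpoint closer to $\rho$ and $e_+$ the farther one. The children of $e$ are the $d$ edges joining $e_+$ to its children. The siblings of an edge are the other $d-1$ edges having the same closer endpoint. Arboreal gas. For a finite graph $G=(V,E)$ and $p\in[0,1)$, $\mathbb{P}_{G,p}$ is the probability measure on $\{0,1\}^E$ with $\mathbb{P}_{G,p}(f)\propto p^{o(f)}(1-p)^{c(f)}\mathbf 1\{f\text{ is a forest}\}$, where $o(f)$ and $c(f)$ are the numbers of open ($f(e)=1$) and closed ($f(e)=0$) edges, and $f$ is a forest if its open edges contain no cycle (two parallel open edges form a cycle). Write $\mathbb{P}_{n,d,p}=\mathbb{P}_{T^{\mathsf w}_{n,d},p}$. Weak convergence means convergence of the joint law of the states of any finite set of edges of $T_d$ (each such set is contained in $E_{n,d}$ for all large $n$). The $(\theta,\alpha)$-tree-indexed Markov process assigns to the edges of $T_d$ values in $\{0',1',2'\}$, generation by generation, starting from the convention that the (fictitious) parent edge of the edges incident to $\rho$ has value $0'$. Given the values so far, the children of distinct edges are assigned values independently as follows. - If $e$ has value $0'$: toss a coin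 with success probability $\theta$. On success, choose one child edge of $e$ uniformly at random and give it value $2'$; each of its $d-1$ siblings independently gets value $1'$ with probability $\alpha$ and $0'$ with probability $1-\alpha$. On failure, each of the $d$ children of $e$ independently gets value $1'$ with probability $\alpha$ and $0'$ with probability $1-\alpha$. - If $e$ has value $2'$: choose one child uniformly at random and give it value $2'$; each of its siblings independently gets $1'$ with probability $\alpha$ and $0'$ with probability $1-\alpha$. - If $e$ has value $1'$: each child independently gets $1'$ with probability $\alpha$ and $0'$ with probability $1-\alpha$. *)

theory Defs
  imports "HOL-Probability.Probability" "HOL-Library.Monad_Syntax"
begin

subsection \<open>Finite multigraphs and the arboreal gas\<close>

text \<open>The set of endpoints of an edge has one element (a loop) or two elements;
  several edges may have the same endpoints.\<close>

record ('v, 'e) multigraph =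
  verts :: "'v set"
  edges :: "'e set"
  ends  :: "'e \<Rightarrow> 'v set"

text \<open>A cycle \<open>vs ! 0, es ! 0, vs ! 1, es ! 1, \<dots>\<close> through pairwise distinct vertices and pairwise
  distinct edges. Length 1 is a loop and length 2 a pair of parallel edges.\<close>

definition is_cycle :: "('v, 'e) multigraph \<Rightarrow> 'v list \<Rightarrow> 'e list \<Rightarrow> bool" where
  "is_cycle G vs es \<longleftrightarrow>
     es \<noteq> [] \<and> length vs = length es \<and> distinct vs \<and> distinct es \<and>
     set vs \<subseteq> verts G \<and> set es \<subseteq> edges G \<and>
     (\<forall>i<length es. ends G (es ! i) = {vs ! i, vs ! (Suc i mod length es)})"

definition is_forest :: "('v, 'e) multigraph \<Rightarrow> ('e \<Rightarrow> bool) \<Rightarrow> bool" where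
  "is_forest G f \<longleftrightarrow> (\<nexists>vs es. is_cycle G vs es \<and> (\<forall>e\<in>set es. f e))"

definition num_open :: "('v, 'e) multigraph \<Rightarrow> ('e \<Rightarrow> bool) \<Rightarrow> nat" where
  "num_open G f = card {e \<in> edges G. f e}"

definition num_closed :: "('v, 'e) multigraph \<Rightarrow> ('e \<Rightarrow> bool) \<Rightarrow> nat" where
  "num_closed G f = card {e \<in> edges G. \<not> f e}"

definition gas_weight :: "('v, 'e) multigraph \<Rightarrow> real \<Rightarrow> ('e \<Rightarrow> bool) \<Rightarrow> real" where
  "gas_weight G p f =
     (if is_forest G f then p ^ num_open G f * (1 - p) ^ num_closed G f else 0)"

text \<open>Elements of \<open>S\<^sup>I\<close> are represented by extensional functions (\<open>undefined\<close> outside \<open>I\<close>), as in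
  the library's product spaces; \<open>S\<close> is a finite type with the discrete sigma algebra.\<close>

definition configs :: "'e set \<Rightarrow> ('e \<Rightarrow> 's) set" where
  "configs I = (\<Pi>\<^sub>E e\<in>I. UNIV)"

definition config_space :: "'e set \<Rightarrow> ('e \<Rightarrow> 's) measure" where
  "config_space I = (\<Pi>\<^sub>M e\<in>I. count_space UNIV)"

definition arboreal_gas :: "('v, 'e) multigraph \<Rightarrow> real \<Rightarrow> ('e \<Rightarrow> bool) measure" where
  "arboreal_gas G p =
     point_measure (configs (edges G))
       (\<lambda>f. ennreal (gas_weight G p f / (\<Sum>g\<in>configs (edges G). gas_weight G p g)))"


subsection \<open>Regular trees and their wired truncations\<close>

text \<open>A vertex of \<open>T\<^sub>d\<close> is the list of child indices on the path from the root \<open>[]\<close> to it. An edge is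
  identified with its endpoint farther from the root, so the edge \<open>e\<close> joins \<open>butlast e\<close> to \<open>e\<close>, and
  its children are the edges \<open>e @ [i]\<close> with \<open>i < d\<close>.\<close>

definition tree_verts :: "nat \<Rightarrow> nat list set" where
  "tree_verts d = {v. set v \<subseteq> {..<d}}"

definition tree_edges :: "nat \<Rightarrow> nat list set" where
  "tree_edges d = tree_verts d - {[]}"

definition trunc_edges :: "nat \<Rightarrow> nat \<Rightarrow> nat list set" where
  "trunc_edges n d = {e \<in> tree_edges d. length e \<le> n}"

text \<open>The quotient map identifying all vertices at distance \<open>n\<close> from the root with \<open>\<partial>\<close>, which is
  represented by \<open>None\<close>.\<close>

definition wire :: "nat \<Rightarrow> nat list \<Rightarrow> nat list option" where
  "wire n v = (if length v = n then None else Some v)"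

definition wired_tree :: "nat \<Rightarrow> nat \<Rightarrow> (nat list option, nat list) multigraph" where
  "wired_tree n d =
     \<lparr>verts = wire n ` {v \<in> tree_verts d. length v \<le> n},
      edges = trunc_edges n d,
      ends = (\<lambda>e. wire n ` {butlast e, e})\<rparr>"


subsection \<open>Joint laws and weak convergence\<close>

definition joint_law :: "('e \<Rightarrow> 's) measure \<Rightarrow> 'e set \<Rightarrow> ('e \<Rightarrow> 's) measure" where
  "joint_law M F = distr M (config_space F) (\<lambda>f. restrict f F)"

text \<open>\<open>M n\<close> may live on configurations indexed by only part of \<open>I\<close>, as long as each finite \<open>F \<subseteq> I\<close>
  is contained in its index set for all large \<open>n\<close>; the other values of \<open>n\<close> do not matter.\<close>

definition converges_weakly ::
    "'e set \<Rightarrow> (nat \<Rightarrow> ('e \<Rightarrow> 's) measure) \<Rightarrow> ('e \<Rightarrow> 's) measure \<Rightarrow> bool" where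
  "converges_weakly I M P \<longleftrightarrow>
     (\<forall>F. finite F \<and> F \<subseteq> I \<longrightarrow>
       (\<forall>A\<in>sets (config_space F).
          (\<lambda>n. measure (joint_law (M n) F) A) \<longlonglongrightarrow> measure (joint_law P F) A))"


subsection \<open>The tree-indexed Markov process\<close>

datatype state = Zero' | One' | Two'

text \<open>The states of the children of one edge are functions of the child index \<open>i < d\<close>.\<close>

definition plain_state :: "real \<Rightarrow> state pmf" where
  "plain_state \<alpha> = map_pmf (\<lambda>b. if b then One' else Zero') (bernoulli_pmf \<alpha>)"

definition plain_children :: "nat \<Rightarrow> real \<Rightarrow> (nat \<Rightarrow> state) pmf" where
  "plain_children d \<alpha> = Pi_pmf {..<d} undefined (\<lambda>_. plain_state \<alpha>)"

definition spine_children :: "nat \<Rightarrow> real \<Rightarrow> (nat \<Rightarrow> state) pmf" where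
  "spine_children d \<alpha> = do {
     k \<leftarrow> pmf_of_set {..<d};
     Pi_pmf {..<d} undefined (\<lambda>i. if i = k then return_pmf Two' else plain_state \<alpha>)
   }"

fun children_law :: "nat \<Rightarrow> real \<Rightarrow> real \<Rightarrow> state \<Rightarrow> (nat \<Rightarrow> state) pmf" where
  "children_law d \<theta> \<alpha> Zero' = do {
     success \<leftarrow> bernoulli_pmf \<theta>;
     if success then spine_children d \<alpha> else plain_children d \<alpha>
   }"
| "children_law d \<theta> \<alpha> Two' = spine_children d \<alpha>"
| "children_law d \<theta> \<alpha> One' = plain_children d \<alpha>"

text \<open>The law of the states of the edges in the first \<open>n\<close> generations. The vertices \<open>v\<close> of generation
  \<open>n\<close> are the farther endpoints of the edges of generation \<open>n\<close> (of the fictitious parent edge if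
  \<open>v = []\<close>), and \<open>y v\<close> gives the states of the children of that edge.\<close>

fun generations :: "nat \<Rightarrow> real \<Rightarrow> real \<Rightarrow> nat \<Rightarrow> (nat list \<Rightarrow> state) pmf" where
  "generations d \<theta> \<alpha> 0 = return_pmf (\<lambda>_. undefined)"
| "generations d \<theta> \<alpha> (Suc n) = do {
     x \<leftarrow> generations d \<theta> \<alpha> n;
     y \<leftarrow> Pi_pmf {v \<in> tree_verts d. length v = n} undefined
            (\<lambda>v. children_law d \<theta> \<alpha> (if v = [] then Zero' else x v));
     return_pmf (\<lambda>e. if e \<in> tree_edges d \<and> length e = Suc n then y (butlast e) (last e) else x e)
   }"

text \<open>\<open>Q\<close> is the law of the whole process. The joint laws on the finite sets \<open>trunc_edges n d\<close>,
  which exhaust \<open>tree_edges d\<close>, determine \<open>Q\<close>.\<close>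

definition is_tree_markov_law ::
    "nat \<Rightarrow> real \<Rightarrow> real \<Rightarrow> (nat list \<Rightarrow> state) measure \<Rightarrow> bool" where
  "is_tree_markov_law d \<theta> \<alpha> Q \<longleftrightarrow>
     prob_space Q \<and> sets Q = sets (config_space (tree_edges d)) \<and>
     (\<forall>n. joint_law Q (trunc_edges n d) =
          joint_law (measure_pmf (generations d \<theta> \<alpha> n)) (trunc_edges n d))"

fun open_state :: "state \<Rightarrow> bool" where
  "open_state Zero' = False"
| "open_state One' = True"
| "open_state Two' = True"

definition project_law :: "nat \<Rightarrow> (nat list \<Rightarrow> state) measure \<Rightarrow> (nat list \<Rightarrow> bool) measure" where
  "project_law d Q =
     distr Q (config_space (tree_edges d)) (\<lambda>x. \<lambda>e\<in>tree_edges d. open_state (x e))"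


lemma finite_trunc_edges: "finite (trunc_edges n d)"
proof -
  have "finite {v. set v \<subseteq> {..<d} \<and> length v \<le> n}"
    by (rule finite_lists_length_le) simp
  then show ?thesis
    by (rule rev_finite_subset) (auto simp: trunc_edges_def tree_edges_def tree_verts_def)
qed

lemma is_tree_markov_law_unique:
  assumes Q: "is_tree_markov_law d \<theta> \<alpha> Q" and Q': "is_tree_markov_law d \<theta> \<alpha> Q'"
  shows "Q = Q'"
proof -
  interpret Q: prob_space Q using Q by (simp add: is_tree_markov_law_def)
  have sets: "sets Q = sets (config_space (tree_edges d))"
    "sets Q' = sets (config_space (tree_edges d))"
    using Q Q' by (simp_all add: is_tree_markov_law_def)
  show ?thesis
  proof (rule measure_eqI_PiM_infinite[where I = "tree_edges d" and M = "\<lambda>_. count_space UNIV"])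
    show "sets Q = sets (PiM (tree_edges d) (\<lambda>_. count_space UNIV))"
      "sets Q' = sets (PiM (tree_edges d) (\<lambda>_. count_space UNIV))"
      using sets by (simp_all add: config_space_def)
    show "finite_measure Q" by (rule Q.finite_measure_axioms)
    fix A :: "nat list \<Rightarrow> state set" and J
    assume J: "finite J" "J \<subseteq> tree_edges d"
    define X where "X = prod_emb (tree_edges d) (\<lambda>_. count_space UNIV) J (Pi\<^sub>E J A)"
    define n where "n = Max (insert 0 (length ` J))"
    define E where "E = trunc_edges n d"
    have JE: "J \<subseteq> E"
      using J by (auto simp: E_def n_def trunc_edges_def intro!: Max_ge)
    have ET: "E \<subseteq> tree_edges d"
      by (auto simp: E_def trunc_edges_def)
    have cyl: "emeasure R X = emeasure (joint_law R E)
        (prod_emb E (\<lambda>_. count_space UNIV) J (Pi\<^sub>E J A))"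
      if R: "sets R = sets (config_space (tree_edges d))" for R
    proof -
      have m: "(\<lambda>f. restrict f E) \<in> measurable R (config_space E)"
        unfolding measurable_cong_sets[OF R refl] unfolding config_space_def
        by (rule measurable_restrict_subset) fact
      have s: "prod_emb E (\<lambda>_. count_space UNIV) J (Pi\<^sub>E J A) \<in> sets (config_space E)"
        unfolding config_space_def using J JE by (intro sets_PiM_I) auto
      have sp: "space R = space (config_space (tree_edges d))"
        using R by (rule sets_eq_imp_space_eq)
      show ?thesis
        unfolding joint_law_def
        by (subst emeasure_distr[OF m s], rule arg_cong[where f = "emeasure R"])
          (use JE ET in \<open>auto simp: X_def prod_emb_def sp config_space_def space_PiM PiE_iff
             extensional_def restrict_def split: if_splits, blast\<close>)
    qed
    show "emeasure Q X = emeasure Q' X"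
      using Q Q' cyl[OF sets(1)] cyl[OF sets(2)] by (simp add: is_tree_markov_law_def E_def)
  qed
qed

end

theory Submission
  imports Defs
begin

text \<open>
  In a wired tree an open subgraph fails to be a forest exactly when from some vertex two open paths
  lead away from the root to the boundary through different children. Recording for every open edge
  whether its far end is joined to the boundary below it (\<open>Two'\<close>) or not (\<open>One'\<close>) turns this global
  condition into a local one, \<open>compatible\<close>: a \<open>Two'\<close> has exactly one \<open>Two'\<close> child, a \<open>One'\<close> has
  none, and a \<open>Zero'\<close> has at most one. Forests correspond bijectively to the labellings that satisfy
  these local conditions and avoid \<open>One'\<close> in the last generation (\<open>consistent_imp_forest\<close>, \<open>forest_imp_consistent_labelling\<close>,
  \<open>consistent_unique\<close>).

  A product weight under such local conditions on a tree is a Markov chain whose transition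
  probabilities are ratios of partition functions of subtrees. If \<open>b\<close> is the conditional probability
  that the top of a subtree of height \<open>h\<close> is joined to the boundary, then the probability for height
  \<open>h + 1\<close> is \<open>d p b / (1 + (d - 1) p b)\<close>, and a child edge that is not \<open>Two'\<close> is open with
  probability \<open>p (1 - b) / (1 - p b)\<close>. With these parameters the children law of the process
  in the theorem satisfies an exact factorization (\<open>step_identity\<close>) whose product over the tree
  telescopes, so that the gas on the truncation of height \<open>n\<close> is the image of an inhomogeneous version
  of the process (\<open>arboreal_gas_eq_chain\<close>). No partition function has to be computed, since two
  proportional probability measures are equal.

  Seen from the root, the subtree heights tend to infinity with \<open>n\<close>. The recursion for \<open>b\<close> started
  at \<open>1\<close> decreases to its largest nonnegative fixed point, which is \<open>\<theta>\<close>, and the second parameter then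
  tends to \<open>\<alpha>\<close> (\<open>reach_prob_tendsto\<close>, \<open>plain_rate_tendsto\<close>). The probability of each configuration of
  finitely many generations is a finite product of transition probabilities, hence converges to the
  corresponding probability for the homogeneous process. Both the approximating chains and the limit
  are realized on the infinite tree by letting every vertex carry an independent random
  map from its own state to the states of its children (\<open>measure_joint_law_chain\<close>).
\<close>

section \<open>Vertices and edges of the truncated trees\<close>

definition level :: "nat \<Rightarrow> nat \<Rightarrow> nat list set" where
  "level d k = {v \<in> tree_verts d. length v = k}"

definition inner_verts :: "nat \<Rightarrow> nat \<Rightarrow> nat list set" where
  "inner_verts d n = {v \<in> tree_verts d. length v < n}"

lemma tree_verts_snoc: "v @ [i] \<in> tree_verts d \<longleftrightarrow> v \<in> tree_verts d \<and> i < d"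
  by (auto simp: tree_verts_def)

lemma trunc_edge_snoc:
  "e \<in> trunc_edges n d \<longleftrightarrow> (\<exists>v i. e = v @ [i] \<and> v \<in> inner_verts d n \<and> i < d)"
  by (cases e rule: rev_cases) (auto simp: trunc_edges_def tree_edges_def inner_verts_def tree_verts_snoc)

lemma finite_inner_verts [simp]: "finite (inner_verts d n)"
  by (rule finite_subset[OF _ finite_lists_length_le[of "{..<d}" n]])
     (auto simp: inner_verts_def tree_verts_def)

lemma finite_level [simp]: "finite (level d n)"
  by (rule finite_subset[OF _ finite_lists_length_le[of "{..<d}" n]])
     (auto simp: level_def tree_verts_def)

lemma inner_verts_Suc: "inner_verts d (Suc n) = inner_verts d n \<union> level d n"
  by (auto simp: inner_verts_def level_def)

lemma disjoint_inner_verts_level: "inner_verts d n \<inter> level d n = {}"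
  by (auto simp: inner_verts_def level_def)

lemma prod_inner_verts_Suc: "prod f (inner_verts d (Suc n)) = prod f (inner_verts d n) * prod f (level d n)"
  by (simp add: inner_verts_Suc prod.union_disjoint disjoint_inner_verts_level)

lemma trunc_edges_subset: "trunc_edges n d \<subseteq> tree_edges d"
  by (auto simp: trunc_edges_def)

lemma trunc_edges_mono: "m \<le> n \<Longrightarrow> trunc_edges m d \<subseteq> trunc_edges n d"
  by (auto simp: trunc_edges_def)

lemma tree_edge_snoc: "e \<in> tree_edges d \<longleftrightarrow> (\<exists>v i. e = v @ [i] \<and> v \<in> tree_verts d \<and> i < d)"
  by (cases e rule: rev_cases) (auto simp: tree_edges_def tree_verts_snoc)

lemma snoc_in_trunc_edges: "v \<in> inner_verts d n \<Longrightarrow> i < d \<Longrightarrow> v @ [i] \<in> trunc_edges n d"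
  by (auto simp: trunc_edge_snoc)

lemma prod_level_Suc: "prod g (level d (Suc m)) = (\<Prod>v\<in>level d m. \<Prod>i<d. g (v @ [i]))"
proof -
  have "bij_betw (\<lambda>(v, i). v @ [i]) (level d m \<times> {..<d}) (level d (Suc m))"
    unfolding bij_betw_def
  proof
    show "(\<lambda>(v, i). v @ [i]) ` (level d m \<times> {..<d}) = level d (Suc m)"
    proof safe
      fix e assume e: "e \<in> level d (Suc m)"
      then obtain v i where "e = v @ [i]" by (cases e rule: rev_cases) (auto simp: level_def)
      then show "e \<in> (\<lambda>(v, i). v @ [i]) ` (level d m \<times> {..<d})"
        using e by (auto simp: level_def tree_verts_snoc image_iff)
    qed (simp add: level_def tree_verts_snoc)
  qed (auto intro!: inj_onI)
  then have "prod g (level d (Suc m)) = (\<Prod>z\<in>level d m \<times> {..<d}. g (case z of (v, i) \<Rightarrow> v @ [i]))"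
    by (rule prod.reindex_bij_betw[symmetric])
  then show ?thesis by (simp add: prod.cartesian_product case_prod_unfold)
qed

lemma prod_trunc_edges_Suc:
  "prod g (trunc_edges (Suc m) d) = prod g (trunc_edges m d) * (\<Prod>v\<in>level d m. \<Prod>i<d. g (v @ [i]))"
proof -
  have "trunc_edges (Suc m) d = trunc_edges m d \<union> level d (Suc m)"
    by (auto simp: trunc_edges_def level_def tree_edges_def)
  moreover have "trunc_edges m d \<inter> level d (Suc m) = {}"
    by (auto simp: trunc_edges_def level_def)
  ultimately show ?thesis
    by (simp add: prod.union_disjoint finite_trunc_edges prod_level_Suc)
qed

lemma UNIV_state: "UNIV = {Zero', One', Two'}"
  by (auto intro: state.exhaust)

lemma finite_UNIV_state [simp]: "finite (UNIV :: state set)"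
  by (simp add: UNIV_state)

lemma config_space_finite:
  assumes "finite F" "finite (UNIV :: 's set)"
  shows "config_space F = count_space (configs F :: ('e \<Rightarrow> 's) set)"
  unfolding config_space_def configs_def
  using assms by (intro count_space_PiM_finite) (auto intro: countable_finite)

lemma finite_configs:
  assumes "finite F" "finite (UNIV :: 's set)"
  shows "finite (configs F :: ('e \<Rightarrow> 's) set)"
  unfolding configs_def using assms by (intro finite_PiE) auto

lemma restrict_in_configs [simp]: "restrict f F \<in> configs F"
  by (simp add: configs_def)

section \<open>Forests in wired trees\<close>

text \<open>On a cycle there are as many vertices as edges, so if no two open edges have the same tail, every
  vertex of the cycle is the tail of one of its edges. For a vertex at which the potential \<open>g\<close> is
  maximal on the cycle this contradicts the increase of \<open>g\<close> along that edge.\<close>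
lemma forest_of_increasing_orientation:
  fixes g :: "'v \<Rightarrow> int"
  assumes ends: "\<And>e. e \<in> edges G \<Longrightarrow> f e \<Longrightarrow> ends G e = {tail e, head e}"
    and less: "\<And>e. e \<in> edges G \<Longrightarrow> f e \<Longrightarrow> g (tail e) < g (head e)"
    and inj: "inj_on tail {e \<in> edges G. f e}"
  shows "is_forest G f"
  unfolding is_forest_def
proof safe
  fix vs es assume c: "is_cycle G vs es" and op: "\<forall>e\<in>set es. f e"
  have es: "es \<noteq> []" "length vs = length es" "distinct vs" "distinct es" "set es \<subseteq> edges G"
    and en: "\<And>i. i < length es \<Longrightarrow> ends G (es ! i) = {vs ! i, vs ! (Suc i mod length es)}"
    using c unfolding is_cycle_def by blast+
  have sub: "{tail e, head e} \<subseteq> set vs" if e: "e \<in> set es" for e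
  proof -
    obtain i where i: "i < length es" "e = es ! i" using e by (auto simp: in_set_conv_nth)
    have "Suc i mod length es < length vs" using es by simp
    then have "ends G e \<subseteq> set vs" using en[OF i(1)] i es(2) by simp
    moreover have "ends G e = {tail e, head e}" using e es(5) op by (intro ends) auto
    ultimately show ?thesis by simp
  qed
  have "inj_on tail (set es)" using es(5) op by (intro inj_on_subset[OF inj]) auto
  then have "card (tail ` set es) = card (set vs)"
    using es by (simp add: card_image distinct_card)
  moreover have "tail ` set es \<subseteq> set vs" using sub by auto
  ultimately have surj: "tail ` set es = set vs" by (intro card_subset_eq) auto
  have "vs \<noteq> []" using es by auto
  then obtain v where v: "v \<in> set vs" "\<And>w. w \<in> set vs \<Longrightarrow> g w \<le> g v"
  proof -
    have "Max (g ` set vs) \<in> g ` set vs" using \<open>vs \<noteq> []\<close> by (intro Max_in) auto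
    then obtain v where v: "Max (g ` set vs) = g v" "v \<in> set vs" by (rule imageE)
    show ?thesis by (rule that[OF v(2)]) (simp flip: v(1))
  qed
  have "v \<in> tail ` set es" using surj v(1) by simp
  then obtain e where e: "e \<in> set es" "tail e = v" by blast
  have "g v < g (head e)" using less[of e] e es op by auto
  moreover have "head e \<in> set vs" using sub[OF e(1)] by auto
  ultimately show False using v(2)[of "head e"] by simp
qed

lemma is_forest_cong:
  assumes "\<And>e. e \<in> edges G \<Longrightarrow> f e = g e"
  shows "is_forest G f \<longleftrightarrow> is_forest G g"
  using assms unfolding is_forest_def is_cycle_def by (meson subsetD)

text \<open>The root behaves like the far end of a fictitious edge in state \<open>Zero'\<close>.\<close>
definition root_state :: "(nat list \<Rightarrow> state) \<Rightarrow> nat list \<Rightarrow> state" where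
  "root_state x v = (if v = [] then Zero' else x v)"

definition child_state :: "(nat list \<Rightarrow> state) \<Rightarrow> nat list \<Rightarrow> nat \<Rightarrow> state" where
  "child_state x v i = x (v @ [i])"

definition two_children :: "nat \<Rightarrow> (nat \<Rightarrow> state) \<Rightarrow> nat set" where
  "two_children d c = {i. i < d \<and> c i = Two'}"

fun compatible :: "nat \<Rightarrow> state \<Rightarrow> (nat \<Rightarrow> state) \<Rightarrow> bool" where
  "compatible d Zero' c \<longleftrightarrow> card (two_children d c) \<le> 1"
| "compatible d One' c \<longleftrightarrow> card (two_children d c) = 0"
| "compatible d Two' c \<longleftrightarrow> card (two_children d c) = 1"

text \<open>The last condition says that the far end of an edge of the last generation lies on the boundary.
  It speaks of \<^const>\<open>root_state\<close> so that it is vacuous for height \<open>0\<close>.\<close>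
definition consistent :: "nat \<Rightarrow> nat \<Rightarrow> (nat list \<Rightarrow> state) \<Rightarrow> bool" where
  "consistent d n x \<longleftrightarrow>
     (\<forall>v\<in>inner_verts d n. compatible d (root_state x v) (child_state x v)) \<and>
     (\<forall>v\<in>level d n. root_state x v \<noteq> One')"

lemma finite_two_children [simp]: "finite (two_children d c)"
  by (simp add: two_children_def)

lemma compatible_card_le: "compatible d s c \<Longrightarrow> card (two_children d c) \<le> 1"
  by (cases s) auto

lemma compatible_unique_two:
  assumes "compatible d s c" "i < d" "j < d" "c i = Two'" "c j = Two'"
  shows "i = j"
  using compatible_card_le[OF assms(1)] assms(2-)
  by (metis (mono_tags, lifting) One_nat_def card_le_Suc0_iff_eq finite_two_children mem_Collect_eq two_children_def)

text \<open>Each vertex points to the boundary if it can, and otherwise to its parent when the edge to the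
  parent is open: \<open>Two'\<close> edges are oriented away from the root and \<open>One'\<close> edges towards it.
  The local conditions give every vertex at most one outgoing edge, and none to the boundary vertex.
  A directed walk follows \<open>One'\<close> edges up and then \<open>Two'\<close> edges down, so depth, counted negatively at
  vertices that are not entered by a \<open>Two'\<close> edge, increases along it.\<close>
lemma consistent_imp_forest:
  assumes x: "consistent d n x"
  shows "is_forest (wired_tree n d) (\<lambda>e. open_state (x e))"
proof -
  define tail where "tail e = wire n (if x e = One' then e else butlast e)" for e
  define head where "head e = wire n (if x e = One' then butlast e else e)" for e
  define g where "g u = (case u of None \<Rightarrow> int n
      | Some v \<Rightarrow> if root_state x v = Two' then int (length v) else - int (length v))" for u
  have edge: "e \<in> edges (wired_tree n d) \<longleftrightarrow> (\<exists>v i. e = v @ [i] \<and> v \<in> inner_verts d n \<and> i < d)" for e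
    by (simp add: wired_tree_def trunc_edge_snoc)
  have leaf: "length e < n" if e: "e \<in> edges (wired_tree n d)" "x e = One'" for e
  proof -
    obtain v i where v: "e = v @ [i]" "v \<in> inner_verts d n" "i < d" using e(1) by (auto simp: edge)
    then have "length e = n \<Longrightarrow> root_state x e \<noteq> One'"
      using x by (simp add: consistent_def level_def inner_verts_def tree_verts_snoc)
    moreover have "root_state x e = One'" "length e \<le> n"
      using v e(2) by (simp_all add: root_state_def inner_verts_def)
    ultimately show ?thesis by (meson le_neq_implies_less)
  qed
  have comp: "compatible d (root_state x v) (child_state x v)" if "v \<in> inner_verts d n" for v
    using x that by (auto simp: consistent_def)
  show ?thesis
  proof (rule forest_of_increasing_orientation[where tail = tail and head = head and g = g])
    fix e assume e: "e \<in> edges (wired_tree n d)" "open_state (x e)"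
    show "ends (wired_tree n d) e = {tail e, head e}"
      by (auto simp: wired_tree_def tail_def head_def)
    show "g (tail e) < g (head e)"
      using e leaf[of e]
      by (cases "x e") (auto simp: edge tail_def head_def g_def wire_def root_state_def inner_verts_def)
  next
    show "inj_on tail {e \<in> edges (wired_tree n d). open_state (x e)}"
    proof (rule inj_onI, clarify)
      fix e e' assume e: "e \<in> edges (wired_tree n d)" "open_state (x e)"
        and e': "e' \<in> edges (wired_tree n d)" "open_state (x e')" and eq: "tail e = tail e'"
      have same: "u = w" if "e1 \<in> edges (wired_tree n d)" "e2 \<in> edges (wired_tree n d)"
        "u = (if x e1 = One' then e1 else butlast e1)" "w = (if x e2 = One' then e2 else butlast e2)"
        "wire n u = wire n w" for u w e1 e2
        using that leaf[of e1] leaf[of e2]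
        by (auto simp: wire_def edge inner_verts_def split: if_splits)
      \<comment> \<open>The far end of a \<open>One'\<close> edge has no \<open>Two'\<close> child, so it cannot have two outgoing edges.\<close>
    have conf: False if a: "a \<in> edges (wired_tree n d)" "x a = One'"
        and b: "b \<in> edges (wired_tree n d)" "x b = Two'" "butlast b = a" for a b
      proof -
        obtain i where i: "b = a @ [i]" "a \<in> inner_verts d n" "i < d" using b by (auto simp: edge)
        have "a \<noteq> []" using a by (auto simp: edge)
        then have "two_children d (child_state x a) = {}"
          using comp[OF i(2)] a(2) by (simp add: root_state_def)
        then show False using i b(2) by (auto simp: two_children_def child_state_def)
      qed
      have base: "(if x e = One' then e else butlast e) = (if x e' = One' then e' else butlast e')"
        using same[OF e(1) e'(1) refl refl] eq by (simp add: tail_def)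
      have two: "x a = Two'" if "open_state (x a)" "x a \<noteq> One'" for a
        using that by (cases "x a") auto
      consider "x e = One'" "x e' = One'" | "x e = One'" "x e' = Two'" | "x e = Two'" "x e' = One'"
        | "x e = Two'" "x e' = Two'"
        using two[OF e(2)] two[OF e'(2)] by fast
      then show "e = e'"
      proof cases
        case 1
        then show ?thesis using base by simp
      next
        case 2
        then have "butlast e' = e" using base by simp
        then show ?thesis using conf[OF e(1) 2(1) e'(1) 2(2)] by blast
      next
        case 3
        then have "butlast e = e'" using base by simp
        then show ?thesis using conf[OF e'(1) 3(2) e(1) 3(1)] by blast
      next
        case 4
        then have "butlast e = butlast e'" using base by simp
        with e(1) e'(1) obtain v i j where "e = v @ [i]" "e' = v @ [j]" "i < d" "j < d" "v \<in> inner_verts d n"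
          by (auto simp: edge)
        then show ?thesis
          using compatible_unique_two[OF comp[of v], of i j] 4 by (simp add: child_state_def)
      qed
    qed
  qed
qed

text \<open>\<open>w\<close> lists the child indices along an open path that descends from \<open>v\<close> to generation \<open>n\<close>.\<close>
definition boundary_path ::
    "nat \<Rightarrow> nat \<Rightarrow> (nat list \<Rightarrow> bool) \<Rightarrow> nat list \<Rightarrow> nat list \<Rightarrow> bool" where
  "boundary_path d n f v w \<longleftrightarrow>
     set w \<subseteq> {..<d} \<and> length v + length w = n \<and> (\<forall>k<length w. f (v @ take (Suc k) w))"

definition open_to_boundary :: "nat \<Rightarrow> nat \<Rightarrow> (nat list \<Rightarrow> bool) \<Rightarrow> nat list \<Rightarrow> bool" where
  "open_to_boundary d n f v \<longleftrightarrow> (\<exists>w. boundary_path d n f v w)"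

lemma boundary_path_Nil: "boundary_path d n f v [] \<longleftrightarrow> length v = n"
  by (simp add: boundary_path_def)

lemma boundary_path_Cons:
  "boundary_path d n f v (i # w) \<longleftrightarrow> i < d \<and> f (v @ [i]) \<and> boundary_path d n f (v @ [i]) w"
  by (auto simp: boundary_path_def All_less_Suc2)

lemma open_to_boundary_step:
  assumes "length v < n"
  shows "open_to_boundary d n f v \<longleftrightarrow>
    (\<exists>i<d. f (v @ [i]) \<and> open_to_boundary d n f (v @ [i]))"
proof
  assume "open_to_boundary d n f v"
  then obtain w where w: "boundary_path d n f v w" by (auto simp: open_to_boundary_def)
  with assms obtain i u where "w = i # u" by (cases w) (auto simp: boundary_path_Nil)
  with w show "\<exists>i<d. f (v @ [i]) \<and> open_to_boundary d n f (v @ [i])"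
    by (auto simp: open_to_boundary_def boundary_path_Cons)
next
  assume "\<exists>i<d. f (v @ [i]) \<and> open_to_boundary d n f (v @ [i])"
  then obtain i u where "boundary_path d n f v (i # u)"
    by (auto simp: open_to_boundary_def boundary_path_Cons)
  then show "open_to_boundary d n f v" by (auto simp: open_to_boundary_def)
qed

text \<open>Two paths from \<open>v\<close> that leave through different children never meet again in the tree, and
  wiring the boundary joins their ends. The cycle descends along the first path in
  its first \<open>L\<close> steps and returns along the second one; if \<open>L = 1\<close> it is a pair of parallel edges.\<close>
lemma two_boundary_paths_not_forest:
  assumes v: "v \<in> tree_verts d"
    and paths: "boundary_path d n f v w" "boundary_path d n f v w'"
    and ne: "w \<noteq> []" "w' \<noteq> []" "hd w \<noteq> hd w'"
  shows "\<not> is_forest (wired_tree n d) f"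
proof -
  have w: "set w \<subseteq> {..<d}" "length v + length w = n" "\<forall>k<length w. f (v @ take (Suc k) w)"
    and w': "set w' \<subseteq> {..<d}" "length v + length w' = n" "\<forall>k<length w'. f (v @ take (Suc k) w')"
    using paths by (auto simp: boundary_path_def)
  define L where "L = length w"
  have L: "length w = L" "length w' = L" "L > 0" "length v + L = n"
    using w w' ne by (auto simp: L_def)
  \<comment> \<open>At \<open>k = L\<close> the second branch describes the boundary vertex, reached by the whole of \<open>w'\<close>.\<close>
  define V where "V k = wire n (if k < L then v @ take k w else v @ take (2 * L - k) w')" for k
  define E where "E k = (if k < L then v @ take (Suc k) w else v @ take (2 * L - k) w')" for k
  have hd: "take a w \<noteq> take b w'" if "a > 0 \<or> b > 0" "a \<le> L" "b \<le> L" for a b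
  proof
    assume eq: "take a w = take b w'"
    then have "a = b" using that L by (metis length_take min.absorb2)
    with that have "a > 0" "b > 0" by auto
    then show False using eq ne by (metis hd_take)
  qed
  have take_ne: "take a u \<noteq> take b u" if "a < b" "b \<le> length u" for a b and u :: "nat list"
    using that by (metis length_take min.absorb2 nat_less_le order.strict_trans1)
  have inV: "inj_on V {..<2 * L}"
  proof (rule linorder_inj_onI')
    fix i j assume ij: "i \<in> {..<2 * L}" "j \<in> {..<2 * L}" "i < j"
    have "take (2 * L - i) w' \<noteq> take (2 * L - j) w'" if "\<not> i < L"
      using take_ne[of "2 * L - j" "2 * L - i" w'] ij L that by fastforce
    with ij show "V i \<noteq> V j"
      using hd[of i "2 * L - j"] take_ne[of i j w] take_ne[of "2 * L - j" "2 * L - i" w'] L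
      by (auto simp: V_def wire_def split: if_splits)
  qed
  have inE: "inj_on E {..<2 * L}"
  proof (rule linorder_inj_onI')
    fix i j assume ij: "i \<in> {..<2 * L}" "j \<in> {..<2 * L}" "i < j"
    have "take (2 * L - i) w' \<noteq> take (2 * L - j) w'" if "\<not> i < L"
      using take_ne[of "2 * L - j" "2 * L - i" w'] ij L that by fastforce
    with ij show "E i \<noteq> E j"
      using hd[of "Suc i" "2 * L - j"] take_ne[of "Suc i" "Suc j" w] take_ne[of "2 * L - j" "2 * L - i" w'] L
      by (auto simp: E_def split: if_splits)
  qed
  have sub: "set (v @ take k w) \<subseteq> {..<d}" "set (v @ take k w') \<subseteq> {..<d}" for k
    using v w(1) w'(1) by (auto simp: tree_verts_def dest: in_set_takeD)
  have bl: "butlast (v @ take (Suc k) u) = v @ take k u" if "k < length u" for k u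
    using that by (simp add: take_Suc_conv_app_nth butlast_append)
  have ends: "ends (wired_tree n d) (E k) = {V k, V (Suc k mod (2 * L))}" if k: "k < 2 * L" for k
  proof (cases "k < L")
    case True
    then have "Suc k mod (2 * L) = Suc k" by simp
    moreover have "V (Suc k) = wire n (v @ take (Suc k) w)"
      using True L by (cases "Suc k < L") (auto simp: V_def wire_def)
    ultimately show ?thesis using True bl[of k w] L by (simp add: wired_tree_def E_def V_def)
  next
    case False
    define j where "j = 2 * L - Suc k"
    have j: "2 * L - k = Suc j" "j < L" using False k by (auto simp: j_def)
    have "V (Suc k mod (2 * L)) = wire n (v @ take j w')"
    proof (cases "Suc k < 2 * L")
      case True
      then show ?thesis using False by (simp add: V_def j_def)
    next
      case F: False
      then have "Suc k = 2 * L" using k by simp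
      then show ?thesis using L by (simp add: V_def j_def)
    qed
    then show ?thesis using False j bl[of j w'] L by (auto simp: wired_tree_def E_def V_def)
  qed
  have "is_cycle (wired_tree n d) (map V [0..<2 * L]) (map E [0..<2 * L])"
    unfolding is_cycle_def
  proof (intro conjI)
    show "set (map V [0..<2 * L]) \<subseteq> verts (wired_tree n d)"
    proof -
      have "V k \<in> verts (wired_tree n d)" for k
        using sub(1)[of k] sub(2)[of "2 * L - k"] L
        by (cases "k < L") (simp_all add: V_def wired_tree_def tree_verts_def)
      then show ?thesis by auto
    qed
    show "set (map E [0..<2 * L]) \<subseteq> edges (wired_tree n d)"
    proof -
      have "set (E k) \<subseteq> {..<d}" "E k \<noteq> []" "length (E k) \<le> n" if "k < 2 * L" for k
        using that sub(1)[of "Suc k"] sub(2)[of "2 * L - k"] L ne by (auto simp: E_def)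
      then have "E k \<in> edges (wired_tree n d)" if "k < 2 * L" for k
        using that by (simp add: wired_tree_def trunc_edges_def tree_edges_def tree_verts_def)
      then show ?thesis by auto
    qed
  qed (use L inV inE ends in \<open>auto simp: distinct_map atLeast0LessThan\<close>)
  moreover have "f (E k)" if "k < 2 * L" for k
    using that w(3) w'(3)[rule_format, of "2 * L - Suc k"] L
    by (auto simp: E_def Suc_diff_Suc)
  then have "\<forall>e\<in>set (map E [0..<2 * L]). f e" by simp
  ultimately show ?thesis unfolding is_forest_def by blast
qed

definition labelling :: "nat \<Rightarrow> nat \<Rightarrow> (nat list \<Rightarrow> bool) \<Rightarrow> nat list \<Rightarrow> state" where
  "labelling d n f e = (if \<not> f e then Zero' else if open_to_boundary d n f e then Two' else One')"

lemma open_labelling [simp]: "open_state (labelling d n f e) = f e"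
  by (simp add: labelling_def)

text \<open>The labelling by existence of a path to the boundary satisfies the local conditions by
  construction, except for the bound on the number of \<open>Two'\<close> children, which is where the absence
  of cycles enters.\<close>
lemma forest_imp_consistent_labelling:
  assumes f: "is_forest (wired_tree n d) f"
  shows "consistent d n (labelling d n f)"
  unfolding consistent_def
proof (intro conjI ballI)
  fix v assume v: "v \<in> inner_verts d n"
  let ?c = "child_state (labelling d n f) v"
  have two: "i \<in> two_children d ?c \<longleftrightarrow> i < d \<and> f (v @ [i]) \<and> open_to_boundary d n f (v @ [i])" for i
    by (auto simp: two_children_def child_state_def labelling_def)
  have step: "open_to_boundary d n f v \<longleftrightarrow> two_children d ?c \<noteq> {}"
    using v open_to_boundary_step[of v n d f] by (auto simp: two inner_verts_def)
  have "i = j" if ij: "i \<in> two_children d ?c" "j \<in> two_children d ?c" for i j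
  proof (rule ccontr)
    assume "i \<noteq> j"
    obtain u where u: "boundary_path d n f v (i # u)"
      using ij(1) by (auto simp: two open_to_boundary_def boundary_path_Cons)
    obtain u' where u': "boundary_path d n f v (j # u')"
      using ij(2) by (auto simp: two open_to_boundary_def boundary_path_Cons)
    have "v \<in> tree_verts d" using v by (simp add: inner_verts_def)
    from two_boundary_paths_not_forest[OF this u u'] show False using \<open>i \<noteq> j\<close> f by simp
  qed
  then have le: "card (two_children d ?c) \<le> 1"
    by (metis One_nat_def card_le_Suc0_iff_eq finite_two_children)
  show "compatible d (root_state (labelling d n f) v) ?c"
  proof (cases "root_state (labelling d n f) v")
    case Zero'
    then show ?thesis using le by simp
  next
    case One'
    then have "\<not> open_to_boundary d n f v"
      by (auto simp: root_state_def labelling_def split: if_splits)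
    then show ?thesis using step One' by simp
  next
    case Two'
    then have "open_to_boundary d n f v"
      by (auto simp: root_state_def labelling_def split: if_splits)
    then have "card (two_children d ?c) > 0" using step by (simp add: card_gt_0_iff)
    then have "card (two_children d ?c) = 1" using le by linarith
    then show ?thesis using Two' by simp
  qed
next
  fix v assume "v \<in> level d n"
  then have "open_to_boundary d n f v"
    unfolding open_to_boundary_def by (intro exI[of _ "[]"]) (simp add: boundary_path_Nil level_def)
  then show "root_state (labelling d n f) v \<noteq> One'" by (simp add: root_state_def labelling_def)
qed

text \<open>The states can be read off from the open edges, starting at the boundary: an edge of the last
  generation is never \<open>One'\<close>, and elsewhere the number of \<open>Two'\<close> children tells \<open>One'\<close> from \<open>Two'\<close>.\<close>
lemma consistent_unique:
  assumes x: "consistent d n x" and y: "consistent d n y"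
    and eq: "\<And>e. e \<in> trunc_edges n d \<Longrightarrow> open_state (x e) = open_state (y e)"
    and e: "e \<in> trunc_edges n d"
  shows "x e = y e"
  using e
proof (induction "n - length e" arbitrary: e rule: less_induct)
  case less
  have e: "e \<in> tree_verts d" "e \<noteq> []" "length e \<le> n"
    using less.prems by (auto simp: trunc_edges_def tree_edges_def)
  show ?case
  proof (cases "length e = n")
    case True
    then have "x e \<noteq> One'" "y e \<noteq> One'"
      using e x y by (auto simp: consistent_def level_def root_state_def)
    then show ?thesis using eq[OF less.prems] by (cases "x e"; cases "y e") auto
  next
    case False
    then have b: "e \<in> inner_verts d n" using e by (auto simp: inner_verts_def)
    have "child_state x e i = child_state y e i" if "i < d" for i
      unfolding child_state_def using less.hyps[of "e @ [i]"] b that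
      by (auto simp: trunc_edge_snoc inner_verts_def)
    then have "two_children d (child_state x e) = two_children d (child_state y e)"
      by (auto simp: two_children_def)
    moreover have "compatible d (x e) (child_state x e)" "compatible d (y e) (child_state y e)"
      using x y b e by (auto simp: consistent_def root_state_def)
    ultimately show ?thesis using eq[OF less.prems] by (cases "x e"; cases "y e") auto
  qed
qed

lemma consistent_cong:
  assumes "\<And>e. e \<in> trunc_edges n d \<Longrightarrow> x e = y e"
  shows "consistent d n x \<longleftrightarrow> consistent d n y"
proof -
  have root: "root_state x v = root_state y v" if "v \<in> inner_verts d n \<union> level d n" for v
    using that assms[of v]
    by (auto simp: root_state_def inner_verts_def level_def trunc_edges_def tree_edges_def)
  have "two_children d (child_state x v) = two_children d (child_state y v)" if "v \<in> inner_verts d n" for v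
    using that assms snoc_in_trunc_edges[of v d n] by (auto simp: two_children_def child_state_def)
  then have "compatible d s (child_state x v) \<longleftrightarrow> compatible d s (child_state y v)"
    if "v \<in> inner_verts d n" for s v
    using that by (cases s) auto
  then show ?thesis using root by (auto simp: consistent_def)
qed

section \<open>The tree-indexed chain driven by independent kernels\<close>

text \<open>Children laws are distributions on functions of all child indices, of which only the first \<open>d\<close>
  carry information; the events of interest therefore prescribe these values only.\<close>
definition agree :: "nat \<Rightarrow> (nat \<Rightarrow> state) \<Rightarrow> (nat \<Rightarrow> state) set" where
  "agree d c = {h. \<forall>i<d. h i = c i}"

definition step_prob ::
    "nat \<Rightarrow> (nat \<Rightarrow> state \<Rightarrow> (nat \<Rightarrow> state) pmf) \<Rightarrow> (nat list \<Rightarrow> state) \<Rightarrow> nat list \<Rightarrow> real" where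
  "step_prob d K x v =
     measure_pmf.prob (K (length v) (root_state x v)) (agree d (child_state x v))"

text \<open>For a tree-indexed Markov chain whose kernel in generation \<open>k\<close> is \<open>K k\<close>, the probability of
  seeing the configuration \<open>x\<close> in the first \<open>m\<close> generations.\<close>
definition path_prob ::
    "nat \<Rightarrow> (nat \<Rightarrow> state \<Rightarrow> (nat \<Rightarrow> state) pmf) \<Rightarrow> nat \<Rightarrow> (nat list \<Rightarrow> state) \<Rightarrow> real" where
  "path_prob d K m x = (\<Prod>v\<in>inner_verts d m. step_prob d K x v)"

text \<open>Each vertex draws the states of its children for all possible states of its own at once. This
  makes the randomness at different vertices independent, so the chain on the infinite tree
  exists as the image of a product measure.\<close>
definition driver ::
    "nat \<Rightarrow> (nat \<Rightarrow> state \<Rightarrow> (nat \<Rightarrow> state) pmf) \<Rightarrow> (nat list \<Rightarrow> state \<Rightarrow> nat \<Rightarrow> state) measure" where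
  "driver d K = (\<Pi>\<^sub>M v\<in>tree_verts d. measure_pmf (Pi_pmf UNIV undefined (K (length v))))"

text \<open>The parent of a vertex drops the last entry of its list, so the recursion runs over reversed
  lists.\<close>
fun driven_rev :: "(nat list \<Rightarrow> state \<Rightarrow> nat \<Rightarrow> state) \<Rightarrow> nat list \<Rightarrow> state" where
  "driven_rev \<omega> [] = Zero'"
| "driven_rev \<omega> (i # u) = \<omega> (rev u) (driven_rev \<omega> u) i"

definition driven :: "(nat list \<Rightarrow> state \<Rightarrow> nat \<Rightarrow> state) \<Rightarrow> nat list \<Rightarrow> state" where
  "driven \<omega> v = driven_rev \<omega> (rev v)"

lemma driven_simps [simp]:
  "driven \<omega> [] = Zero'"
  "driven \<omega> (v @ [i]) = \<omega> v (driven \<omega> v) i"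
  by (simp_all add: driven_def)

definition chain ::
    "nat \<Rightarrow> (nat \<Rightarrow> state \<Rightarrow> (nat \<Rightarrow> state) pmf) \<Rightarrow> (nat list \<Rightarrow> state) measure" where
  "chain d K = distr (driver d K) (config_space (tree_edges d)) (\<lambda>\<omega>. restrict (driven \<omega>) (tree_edges d))"

lemma prob_space_driver: "prob_space (driver d K)"
  unfolding driver_def by (rule prob_space_PiM) (rule measure_pmf.prob_space_axioms)

lemma measurable_driven:
  assumes "v \<in> tree_verts d"
  shows "(\<lambda>\<omega>. driven \<omega> v) \<in> measurable (driver d K) (count_space UNIV)"
  using assms
proof (induction v rule: rev_induct)
  case (snoc i v)
  then have v: "v \<in> tree_verts d" by (simp add: tree_verts_snoc)
  have "(\<lambda>\<omega>. \<omega> v) \<in> measurable (driver d K) (count_space UNIV)"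
    using measurable_component_singleton[OF v, of "\<lambda>v. measure_pmf (Pi_pmf UNIV undefined (K (length v)))"]
    unfolding driver_def by (simp cong: measurable_cong_sets)
  then have "(\<lambda>\<omega>. \<omega> v s i) \<in> measurable (driver d K) (count_space UNIV)" for s
    by (rule measurable_compose) simp
  then show ?case
    unfolding driven_simps
    using snoc.IH[OF v] by (rule measurable_compose_countable') (simp add: countable_finite)
qed simp

lemma measurable_chain_map:
  "(\<lambda>\<omega>. restrict (driven \<omega>) (tree_edges d)) \<in> measurable (driver d K) (config_space (tree_edges d))"
  unfolding config_space_def
  by (rule measurable_restrict, rule measurable_driven) (simp add: tree_edges_def)

lemma prob_space_chain: "prob_space (chain d K)"
  unfolding chain_def
  by (rule prob_space.prob_space_distr[OF prob_space_driver measurable_chain_map])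

lemma sets_chain: "sets (chain d K) = sets (config_space (tree_edges d))"
  by (simp add: chain_def)

text \<open>On the event that the chain takes the values \<open>x\<close>, every vertex uses its random map at the state
  prescribed by \<open>x\<close>. The event is thus a cylinder, with one condition for each vertex.\<close>
lemma driven_eq_iff:
  "(\<forall>e\<in>trunc_edges m d. driven \<omega> e = x e) \<longleftrightarrow>
   (\<forall>v\<in>inner_verts d m. \<forall>i<d. \<omega> v (root_state x v) i = x (v @ [i]))"
proof (intro iffI ballI allI impI)
  fix v i assume eq: "\<forall>e\<in>trunc_edges m d. driven \<omega> e = x e" and v: "v \<in> inner_verts d m" "i < d"
  have "driven \<omega> v = root_state x v"
    using eq v by (auto simp: root_state_def trunc_edges_def tree_edges_def inner_verts_def)
  moreover have "driven \<omega> (v @ [i]) = x (v @ [i])"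
    using eq snoc_in_trunc_edges[OF v] by blast
  ultimately show "\<omega> v (root_state x v) i = x (v @ [i])" by simp
next
  fix e assume eq: "\<forall>v\<in>inner_verts d m. \<forall>i<d. \<omega> v (root_state x v) i = x (v @ [i])"
    and e: "e \<in> trunc_edges m d"
  show "driven \<omega> e = x e" using e
  proof (induction e rule: rev_induct)
    case Nil
    then show ?case by (simp add: trunc_edges_def tree_edges_def)
  next
    case (snoc i v)
    then have v: "v \<in> inner_verts d m" "i < d" by (auto simp: trunc_edge_snoc)
    then have "v \<noteq> [] \<Longrightarrow> v \<in> trunc_edges m d"
      by (auto simp: trunc_edges_def tree_edges_def inner_verts_def)
    then have "driven \<omega> v = root_state x v" using snoc.IH by (auto simp: root_state_def)
    then show ?case using eq v by simp
  qed
qed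

lemma measurable_restrict_chain:
  assumes "F \<subseteq> tree_edges d"
  shows "(\<lambda>f. restrict f F) \<in> measurable (chain d K) (config_space F)"
  unfolding measurable_cong_sets[OF sets_chain refl] unfolding config_space_def
  by (rule measurable_restrict_subset) fact

lemma measure_joint_law_chain:
  assumes x: "x \<in> configs (trunc_edges m d)"
  shows "measure (joint_law (chain d K) (trunc_edges m d)) {x} = path_prob d K m x"
proof -
  let ?E = "trunc_edges m d"
  let ?M = "\<lambda>v. measure_pmf (Pi_pmf UNIV undefined (K (length v)))"
  interpret product_prob_space ?M "tree_verts d" by unfold_locales
  let ?B = "\<lambda>v. {g :: state \<Rightarrow> nat \<Rightarrow> state. g (root_state x v) \<in> agree d (child_state x v)}"
  have sing: "{x} \<in> sets (config_space ?E)"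
    using x by (simp add: config_space_finite finite_trunc_edges)
  have ext: "f = x \<longleftrightarrow> (\<forall>e\<in>?E. f e = x e)" if "f \<in> extensional ?E" for f
    using that x by (auto simp: configs_def PiE_iff intro: extensionalityI)
  have sub: "inner_verts d m \<subseteq> tree_verts d" by (auto simp: inner_verts_def)
  have "measure (joint_law (chain d K) ?E) {x} =
      measure (chain d K) ((\<lambda>f. restrict f ?E) -` {x} \<inter> space (chain d K))"
    unfolding joint_law_def
    by (rule measure_distr[OF measurable_restrict_chain[OF trunc_edges_subset] sing])
  also have "\<dots> = measure (driver d K) ((\<lambda>\<omega>. restrict (driven \<omega>) (tree_edges d)) -`
      ((\<lambda>f. restrict f ?E) -` {x} \<inter> space (chain d K)) \<inter> space (driver d K))"
    unfolding chain_def
    by (rule measure_distr[OF measurable_chain_map])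
       (use measurable_sets[OF measurable_restrict_chain[OF trunc_edges_subset] sing]
         in \<open>simp add: sets_chain flip: chain_def\<close>)
  also have "(\<lambda>\<omega>. restrict (driven \<omega>) (tree_edges d)) -`
      ((\<lambda>f. restrict f ?E) -` {x} \<inter> space (chain d K)) \<inter> space (driver d K) =
      {\<omega> \<in> space (driver d K). \<forall>e\<in>?E. driven \<omega> e = x e}"
    using trunc_edges_subset[of m d] measurable_space[OF measurable_chain_map[of d K]]
    by (auto simp: chain_def ext Int_absorb1)
  also have "\<dots> = prod_emb (tree_verts d) ?M (inner_verts d m) (Pi\<^sub>E (inner_verts d m) ?B)"
    unfolding driven_eq_iff
    using sub by (auto simp: driver_def space_PiM prod_emb_def agree_def child_state_def PiE_iff
        restrict_def extensional_def)
  also have "measure (driver d K) \<dots> = (\<Prod>v\<in>inner_verts d m. measure (?M v) (?B v))"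
    unfolding driver_def by (rule measure_PiM_emb[OF sub]) simp_all
  also have "\<dots> = path_prob d K m x"
    unfolding path_prob_def
  proof (intro prod.cong refl)
    fix v
    have "measure (?M v) (?B v) =
        measure_pmf.prob (map_pmf (\<lambda>g. g (root_state x v)) (Pi_pmf UNIV undefined (K (length v))))
          (agree d (child_state x v))"
      by (simp add: vimage_def)
    then show "measure (?M v) (?B v) = step_prob d K x v"
      by (simp add: Pi_pmf_component step_prob_def)
  qed
  finally show ?thesis .
qed

lemma prob_space_joint_law_chain:
  assumes "F \<subseteq> tree_edges d"
  shows "prob_space (joint_law (chain d K) F)"
  unfolding joint_law_def
  by (rule prob_space.prob_space_distr[OF prob_space_chain measurable_restrict_chain[OF assms]])

lemma measure_joint_law_chain_sum:
  assumes B: "B \<subseteq> configs (trunc_edges m d)"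
  shows "measure (joint_law (chain d K) (trunc_edges m d)) B = (\<Sum>x\<in>B. path_prob d K m x)"
proof -
  interpret prob_space "joint_law (chain d K) (trunc_edges m d)"
    by (rule prob_space_joint_law_chain[OF trunc_edges_subset])
  have "sets (joint_law (chain d K) (trunc_edges m d)) = Pow (configs (trunc_edges m d))"
    by (simp add: joint_law_def config_space_finite finite_trunc_edges)
  moreover have "finite B"
    using B by (rule finite_subset) (simp add: finite_configs finite_trunc_edges)
  ultimately have "measure (joint_law (chain d K) (trunc_edges m d)) B =
      (\<Sum>x\<in>B. measure (joint_law (chain d K) (trunc_edges m d)) {x})"
    using B by (intro finite_measure_eq_sum_singleton) auto
  also have "\<dots> = (\<Sum>x\<in>B. path_prob d K m x)"
    using B by (intro sum.cong refl measure_joint_law_chain) auto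
  finally show ?thesis .
qed

lemma prob_bind_pmf:
  "measure_pmf.prob (bind_pmf M f) A = (\<integral>x. measure_pmf.prob (f x) A \<partial>M)"
proof -
  have eq: "measure_pmf.prob N A = pmf (map_pmf (\<lambda>x. x \<in> A) N) True" for N
    by (simp add: pmf_map vimage_def)
  show ?thesis by (simp add: eq map_bind_pmf pmf_bind)
qed

lemma path_prob_Suc:
  "path_prob d K (Suc n) x = path_prob d K n x * (\<Prod>v\<in>level d n. step_prob d K x v)"
  by (simp add: path_prob_def prod_inner_verts_Suc)

text \<open>The generation-by-generation construction has the same path probabilities, because the kernels
  used in a new generation depend only on states that the event already prescribes.\<close>
lemma generations_prob:
  "measure_pmf.prob (generations d \<theta> \<alpha> n) {z. \<forall>e\<in>trunc_edges n d. z e = x e} =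
     path_prob d (\<lambda>_. children_law d \<theta> \<alpha>) n x"
proof (induction n)
  case 0
  have "trunc_edges 0 d = {}" "inner_verts d 0 = {}"
    by (auto simp: trunc_edges_def tree_edges_def inner_verts_def)
  then show ?case by (simp add: path_prob_def)
next
  case (Suc n)
  let ?K = "\<lambda>_ :: nat. children_law d \<theta> \<alpha>"
  let ?G = "{z. \<forall>e\<in>trunc_edges n d. z e = x e}" and ?G' = "{z. \<forall>e\<in>trunc_edges (Suc n) d. z e = x e}"
  let ?P = "\<lambda>z. Pi_pmf (level d n) undefined (\<lambda>v. children_law d \<theta> \<alpha> (root_state z v))"
  let ?comb = "\<lambda>z y e. if e \<in> tree_edges d \<and> length e = Suc n then y (butlast e) (last e) else z e"
  have gen: "generations d \<theta> \<alpha> (Suc n) = bind_pmf (generations d \<theta> \<alpha> n) (\<lambda>z. map_pmf (?comb z) (?P z))"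
    by (simp add: map_pmf_def level_def root_state_def)
  have last: "v @ [i] \<in> tree_edges d \<longleftrightarrow> v \<in> tree_verts d \<and> i < d" for v i
    by (simp add: tree_edge_snoc)
  have event: "?comb z y \<in> ?G' \<longleftrightarrow> z \<in> ?G \<and> y \<in> Pi (level d n) (\<lambda>v. agree d (child_state x v))" for z y
  proof -
    have split: "trunc_edges (Suc n) d = trunc_edges n d \<union> {v @ [i] |v i. v \<in> level d n \<and> i < d}"
      unfolding set_eq_iff Un_iff mem_Collect_eq trunc_edge_snoc inner_verts_Suc by blast
    define c where "c = ?comb z y"
    have new: "c (v @ [i]) = y v i" if "v \<in> level d n" "i < d" for v i
      using that by (simp add: c_def last level_def)
    have old: "c e = z e" if "e \<in> trunc_edges n d" for e
      using that by (auto simp: c_def trunc_edges_def)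
    have "c \<in> ?G' \<longleftrightarrow> z \<in> ?G \<and> y \<in> Pi (level d n) (\<lambda>v. agree d (child_state x v))"
      unfolding split agree_def child_state_def Pi_def mem_Collect_eq ball_Un
      using old new by (fastforce simp: Ball_def)
    then show ?thesis by (simp only: c_def)
  qed
  have step: "measure_pmf.prob (map_pmf (?comb z) (?P z)) ?G' =
      indicator ?G z * (\<Prod>v\<in>level d n. step_prob d ?K x v)" for z
  proof (cases "z \<in> ?G")
    case True
    have "root_state z v = root_state x v" if "v \<in> level d n" for v
      using that True by (auto simp: root_state_def level_def trunc_edges_def tree_edges_def)
    moreover have "measure_pmf.prob (map_pmf (?comb z) (?P z)) ?G' =
        measure_pmf.prob (?P z) (Pi (level d n) (\<lambda>v. agree d (child_state x v)))"
      using True event by (simp add: vimage_def)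
    ultimately show ?thesis
      using True by (simp add: measure_Pi_pmf_Pi step_prob_def)
  next
    case False
    then have none: "?comb z -` ?G' = {}" using event by blast
    have "measure_pmf.prob (map_pmf (?comb z) (?P z)) ?G' = 0"
      unfolding measure_map_pmf none by (rule measure_empty)
    moreover have "indicator ?G z = (0 :: real)" using False by (rule indicator_simps)
    ultimately show ?thesis by (simp only: mult_zero_left)
  qed
  show ?case
    unfolding gen prob_bind_pmf step path_prob_Suc Suc.IH[symmetric] by simp
qed

lemma chain_is_tree_markov_law:
  "is_tree_markov_law d \<theta> \<alpha> (chain d (\<lambda>_. children_law d \<theta> \<alpha>))"
  unfolding is_tree_markov_law_def
proof (intro conjI allI)
  let ?Q = "chain d (\<lambda>_. children_law d \<theta> \<alpha>)"
  show "prob_space ?Q" "sets ?Q = sets (config_space (tree_edges d))"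
    by (rule prob_space_chain sets_chain)+
  fix n
  let ?E = "trunc_edges n d"
  let ?G = "measure_pmf (generations d \<theta> \<alpha> n)"
  have sets: "sets (joint_law R ?E) = Pow (configs ?E)" for R :: "(nat list \<Rightarrow> state) measure"
    by (simp add: joint_law_def config_space_finite finite_trunc_edges)
  have meas: "(\<lambda>f. restrict f ?E) \<in> measurable ?G (config_space ?E)"
    by (simp add: config_space_finite finite_trunc_edges)
  interpret Q: prob_space "joint_law ?Q ?E"
    by (rule prob_space_joint_law_chain[OF trunc_edges_subset])
  interpret G: prob_space "joint_law ?G ?E"
    unfolding joint_law_def by (rule measure_pmf.prob_space_distr[OF meas])
  show "joint_law ?Q ?E = joint_law ?G ?E"
  proof (rule measure_eqI_finite[OF sets sets])
    show "finite (configs ?E :: (nat list \<Rightarrow> state) set)"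
      by (simp add: finite_configs finite_trunc_edges)
    fix x :: "nat list \<Rightarrow> state" assume x: "x \<in> configs ?E"
    have "measure (joint_law ?G ?E) {x} = measure_pmf.prob (generations d \<theta> \<alpha> n) {z. restrict z ?E = x}"
      unfolding joint_law_def using x
      by (subst measure_distr[OF meas]) (simp_all add: config_space_finite finite_trunc_edges vimage_def)
    also have "{z. restrict z ?E = x} = {z. \<forall>e\<in>?E. z e = x e}"
      using x by (auto simp: configs_def PiE_iff extensional_def restrict_def fun_eq_iff)
    finally show "emeasure (joint_law ?Q ?E) {x} = emeasure (joint_law ?G ?E) {x}"
      using generations_prob[of d \<theta> \<alpha> n x] measure_joint_law_chain[OF x, of "\<lambda>_. children_law d \<theta> \<alpha>"]
      by (simp add: Q.emeasure_eq_measure G.emeasure_eq_measure)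
  qed
qed

section \<open>Probabilities of the children\<close>

lemma agree_Pi: "agree d c = Pi {..<d} (\<lambda>i. {c i})"
  by (auto simp: agree_def)

lemma pmf_plain_state:
  assumes "0 \<le> \<alpha>" "\<alpha> \<le> 1"
  shows "pmf (plain_state \<alpha>) Zero' = 1 - \<alpha>" "pmf (plain_state \<alpha>) One' = \<alpha>"
    "pmf (plain_state \<alpha>) Two' = 0"
proof -
  have "(\<lambda>b. if b then One' else Zero') -` {Zero'} = {False}"
    "(\<lambda>b. if b then One' else Zero') -` {One'} = {True}"
    "(\<lambda>b. if b then One' else Zero') -` {Two'} = {}" by (auto split: if_splits)
  then show "pmf (plain_state \<alpha>) Zero' = 1 - \<alpha>" "pmf (plain_state \<alpha>) One' = \<alpha>"
    "pmf (plain_state \<alpha>) Two' = 0"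
    using assms by (simp_all add: plain_state_def pmf_map measure_pmf_single)
qed

lemma prob_plain_children:
  "measure_pmf.prob (plain_children d \<alpha>) (agree d c) = (\<Prod>i<d. pmf (plain_state \<alpha>) (c i))"
  by (simp add: plain_children_def agree_Pi measure_Pi_pmf_Pi measure_pmf_single)

lemma prob_spine_children:
  assumes "d \<ge> 1"
  shows "measure_pmf.prob (spine_children d \<alpha>) (agree d c) =
    (\<Sum>k<d. \<Prod>i<d. if i = k then of_bool (c i = Two') else pmf (plain_state \<alpha>) (c i)) / real d"
proof -
  have ne: "{..<d} \<noteq> {}" using assms by (metis lessThan_empty_iff not_one_le_zero bot_nat_def)
  have "measure_pmf.prob (Pi_pmf {..<d} undefined
        (\<lambda>i. if i = k then return_pmf Two' else plain_state \<alpha>)) (agree d c) =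
      (\<Prod>i<d. if i = k then of_bool (c i = Two') else pmf (plain_state \<alpha>) (c i))" for k
    by (simp add: agree_Pi measure_Pi_pmf_Pi measure_pmf_single)
       (auto intro!: prod.cong simp: indicator_def)
  then show ?thesis
    unfolding spine_children_def prob_bind_pmf
    by (simp add: integral_pmf_of_set[OF ne])
qed

lemma prob_children_law_Zero:
  assumes "0 \<le> \<theta>" "\<theta> \<le> 1"
  shows "measure_pmf.prob (children_law d \<theta> \<alpha> Zero') A =
    \<theta> * measure_pmf.prob (spine_children d \<alpha>) A + (1 - \<theta>) * measure_pmf.prob (plain_children d \<alpha>) A"
  using assms by (simp add: prob_bind_pmf if_distrib)

section \<open>The finite arboreal gas as an inhomogeneous chain\<close>

text \<open>In the gas on a subtree of height \<open>h\<close>, weigh the forests in which the top vertex is not joined to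
  the boundary by \<open>A\<close> and the others by \<open>B\<close>. For height \<open>h + 1\<close>, with \<open>M = A + (1 - p) B\<close> the weight of
  a child edge that is not \<open>Two'\<close>, the corresponding weights are \<open>M ^ d\<close> and \<open>d p B M ^ (d - 1)\<close>.
  The recursion below is the one for \<open>B / (A + B)\<close>; it starts at \<open>1\<close>, as a vertex on the boundary is
  joined to it.\<close>
fun reach_prob :: "nat \<Rightarrow> real \<Rightarrow> nat \<Rightarrow> real" where
  "reach_prob d p 0 = 1"
| "reach_prob d p (Suc h) = real d * p * reach_prob d p h / (1 + (real d - 1) * p * reach_prob d p h)"

text \<open>The probability \<open>p A / M\<close> of an open child edge, given that the child edge is not \<open>Two'\<close>.\<close>
definition plain_rate :: "nat \<Rightarrow> real \<Rightarrow> nat \<Rightarrow> real" where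
  "plain_rate d p h = p * (1 - reach_prob d p h) / (1 - p * reach_prob d p h)"

text \<open>A vertex of generation \<open>k\<close> is the top of a subtree of height \<open>n - k\<close>, and its children are tops of
  subtrees of height \<open>n - Suc k\<close>.\<close>
definition gas_kernel :: "nat \<Rightarrow> real \<Rightarrow> nat \<Rightarrow> nat \<Rightarrow> state \<Rightarrow> (nat \<Rightarrow> state) pmf" where
  "gas_kernel d p n k = children_law d (reach_prob d p (n - k)) (plain_rate d p (n - Suc k))"

definition edge_weight :: "real \<Rightarrow> state \<Rightarrow> real" where
  "edge_weight p s = (if open_state s then p else 1 - p)"

text \<open>The normalized weight of the subtree of height \<open>h\<close> beyond an edge, given the state of that edge:
  a closed edge leaves both possibilities for its far end.\<close>
fun potential :: "nat \<Rightarrow> real \<Rightarrow> nat \<Rightarrow> state \<Rightarrow> real" where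
  "potential d p h Zero' = 1"
| "potential d p h One' = 1 - reach_prob d p h"
| "potential d p h Two' = reach_prob d p h"

definition step_const :: "nat \<Rightarrow> real \<Rightarrow> nat \<Rightarrow> real" where
  "step_const d p h =
     1 / ((1 - p * reach_prob d p h) ^ (d - 1) * (1 + (real d - 1) * p * reach_prob d p h))"

lemma reach_prob_range:
  assumes "d \<ge> 1" "0 \<le> p" "p < 1"
  shows "0 \<le> reach_prob d p h" "reach_prob d p h \<le> 1"
proof (induction h)
  case (Suc h)
  let ?s = "reach_prob d p h"
  have D: "0 \<le> (real d - 1) * p * ?s" using assms Suc by simp
  have "p * ?s \<le> 1" using assms Suc by (intro mult_le_one) auto
  then have "real d * p * ?s \<le> 1 + (real d - 1) * p * ?s" by (simp add: algebra_simps)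
  with D show "reach_prob d p (Suc h) \<le> 1" by (simp add: divide_le_eq)
  show "0 \<le> reach_prob d p (Suc h)" using assms Suc D by simp
qed simp_all

lemma p_reach_prob_less_1:
  assumes "d \<ge> 1" "0 \<le> p" "p < 1"
  shows "p * reach_prob d p h < 1"
proof -
  have "p * reach_prob d p h \<le> p * 1" using assms reach_prob_range[OF assms] by (intro mult_left_mono) auto
  then show ?thesis using assms by simp
qed

lemma plain_rate_range:
  assumes "d \<ge> 1" "0 \<le> p" "p < 1"
  shows "0 \<le> plain_rate d p h" "plain_rate d p h \<le> 1"
  using p_reach_prob_less_1[OF assms, of h] reach_prob_range[OF assms, of h] assms
  by (simp_all add: plain_rate_def divide_le_eq algebra_simps mult_left_le)

text \<open>For compatible states, the probability of one step of the chain, multiplied by the normalized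
  weight of the subtree at the parent, equals up to a constant the weight of the
  child edges times the normalized weights of the subtrees at the children. Written without division this also covers \<open>p = 0\<close> and \<open>h = 0\<close>, where some of the
  weights vanish.\<close>
lemma step_identity:
  assumes d: "d \<ge> 1" and p: "0 \<le> p" "p < 1"
  shows "measure_pmf.prob (children_law d (reach_prob d p (Suc h)) (plain_rate d p h) s) (agree d c)
        * potential d p (Suc h) s =
      step_const d p h * of_bool (compatible d s c)
        * (\<Prod>i<d. edge_weight p (c i) * potential d p h (c i))"
proof -
  define b where "b = reach_prob d p h"
  define m where "m = 1 - p * b"
  define D where "D = 1 + (real d - 1) * p * b"
  define w where "w = pmf (plain_state (plain_rate d p h))"
  define u where "u s = edge_weight p s * potential d p h s" for s
  define T where "T = two_children d c"
  define U where "U = (\<Prod>i<d. u (c i))"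
  have b: "0 \<le> b" "b \<le> 1" using reach_prob_range[OF assms] by (simp_all add: b_def)
  have m: "m > 0" using p_reach_prob_less_1[OF assms, of h] by (simp add: m_def b_def)
  have D: "D > 0" using b d p by (auto simp: D_def intro!: add_pos_nonneg)
  have Dm: "D = m + real d * p * b" by (simp add: D_def m_def algebra_simps)
  have w: "w Zero' = 1 - plain_rate d p h" "w One' = plain_rate d p h" "w Two' = 0"
    unfolding w_def using plain_rate_range[OF assms] by (simp_all add: pmf_plain_state)
  have wu: "w s = u s / m" if "s \<noteq> Two'" for s
    using that m by (cases s)
      (simp_all add: w u_def edge_weight_def plain_rate_def b_def m_def field_simps)
  have u2: "u Two' = p * b" by (simp add: u_def edge_weight_def b_def)
  have T: "i \<in> T \<longleftrightarrow> i < d \<and> c i = Two'" for i by (auto simp: T_def two_children_def)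
  \<comment> \<open>The factors \<open>m\<close> and \<open>d p b\<close> in the next two claims are, up to \<open>D\<close>, the potentials of \<open>One'\<close> and \<open>Two'\<close>.\<close>
  have plain: "measure_pmf.prob (plain_children d (plain_rate d p h)) (agree d c) * m =
      of_bool (card T = 0) * U / m ^ (d - 1)"
  proof (cases "T = {}")
    case True
    then have "c i \<noteq> Two'" if "i < d" for i using that T by auto
    then have "(\<Prod>i<d. w (c i)) = U / m ^ d" by (simp add: wu U_def prod_dividef)
    moreover have "m ^ d = m ^ (d - 1) * m" using d by (metis One_nat_def Suc_le_D diff_Suc_1 power_Suc2)
    ultimately show ?thesis using True m by (simp add: prob_plain_children w_def)
  next
    case False
    then obtain i where "i < d" "c i = Two'" using T by auto
    then have "(\<Prod>i<d. w (c i)) = 0" using w(3) by (intro prod_zero bexI[of _ i]) simp_all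
    then show ?thesis using False by (simp add: prob_plain_children w_def T_def)
  qed
  have spine: "measure_pmf.prob (spine_children d (plain_rate d p h)) (agree d c) * (real d * p * b) =
      of_bool (card T = 1) * U / m ^ (d - 1)"
  proof -
    let ?g = "\<lambda>k. \<Prod>i<d. if i = k then of_bool (c i = Two') else w (c i)"
    have S: "measure_pmf.prob (spine_children d (plain_rate d p h)) (agree d c) = (\<Sum>k<d. ?g k) / real d"
      unfolding prob_spine_children[OF d] w_def by simp
    \<comment> \<open>Only the choice of the unique \<open>Two'\<close> child can produce the given states.\<close>
    have g0: "?g k = 0" if "k < d" "T \<noteq> {k}" for k
    proof (cases "c k = Two'")
      case True
      then have "k \<in> T" using that(1) by (simp add: T)
      with that(2) obtain j where "j \<in> T" "j \<noteq> k" by blast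
      then have "j < d" "c j = Two'" "j \<noteq> k" by (simp_all add: T)
      then show ?thesis using w(3) by (intro prod_zero bexI[of _ j]) simp_all
    next
      case False
      then show ?thesis using that by (intro prod_zero bexI[of _ k]) simp_all
    qed
    show ?thesis
    proof (cases "card T = 1")
      case True
      then obtain k where k: "T = {k}" by (auto simp: card_Suc_eq)
      then have kd: "k < d" "c k = Two'" using T[of k] by auto
      have other: "c i \<noteq> Two'" if "i \<in> {..<d} - {k}" for i using that k T[of i] by auto
      have "(\<Sum>k<d. ?g k) = (\<Sum>k'\<in>{k}. ?g k')"
        using kd g0 k by (intro sum.mono_neutral_right) auto
      also have "\<dots> = (\<Prod>i\<in>{..<d} - {k}. w (c i))"
        using kd by (simp add: prod.remove[of "{..<d}" k])
      also have "\<dots> = (\<Prod>i\<in>{..<d} - {k}. u (c i)) / m ^ (d - 1)"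
        using other kd by (simp add: wu prod_dividef)
      finally have *: "(\<Sum>k<d. ?g k) = (\<Prod>i\<in>{..<d} - {k}. u (c i)) / m ^ (d - 1)" .
      have "U = p * b * (\<Prod>i\<in>{..<d} - {k}. u (c i))"
        unfolding U_def using kd by (simp add: prod.remove[of "{..<d}" k] u2)
      then show ?thesis using d True by (simp add: S *)
    next
      case False
      then have "?g k = 0" if "k < d" for k using that by (intro g0) auto
      then have "(\<Sum>k<d. ?g k) = 0" by (intro sum.neutral) auto
      then show ?thesis using False by (simp add: S)
    qed
  qed
  have c1: "reach_prob d p (Suc h) = real d * p * b / D" by (simp add: b_def D_def)
  have c2: "1 - reach_prob d p (Suc h) = m / D" using D unfolding c1 by (simp add: Dm field_simps)
  have C: "step_const d p h = 1 / (m ^ (d - 1) * D)" by (simp add: step_const_def m_def D_def b_def)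
  have "measure_pmf.prob (children_law d (reach_prob d p (Suc h)) (plain_rate d p h) s) (agree d c)
        * potential d p (Suc h) s = of_bool (compatible d s c) * U / m ^ (d - 1) / D"
  proof (cases s)
    case Zero'
    have "of_bool (compatible d s c) = (of_bool (card T = 1) + of_bool (card T = 0) :: real)"
      by (auto simp: Zero' T_def le_Suc_eq)
    then have "of_bool (compatible d s c) * U / m ^ (d - 1) / D =
        (of_bool (card T = 1) * U / m ^ (d - 1) + of_bool (card T = 0) * U / m ^ (d - 1)) / D"
      by (simp only: distrib_right add_divide_distrib)
    also have "\<dots> = reach_prob d p (Suc h) * measure_pmf.prob (spine_children d (plain_rate d p h)) (agree d c)
        + (1 - reach_prob d p (Suc h)) * measure_pmf.prob (plain_children d (plain_rate d p h)) (agree d c)"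
      unfolding c2 unfolding c1 plain[symmetric] spine[symmetric]
      by (simp add: add_divide_distrib mult.commute)
    finally show ?thesis
      using reach_prob_range[OF assms, of "Suc h"]
      by (simp add: Zero' prob_children_law_Zero del: reach_prob.simps children_law.simps)
  next
    case One'
    have "of_bool (compatible d s c) * U / m ^ (d - 1) =
        measure_pmf.prob (plain_children d (plain_rate d p h)) (agree d c) * m"
      unfolding plain by (simp add: One' T_def)
    then show ?thesis by (simp add: One' c2 del: reach_prob.simps)
  next
    case Two'
    have "of_bool (compatible d s c) * U / m ^ (d - 1) =
        measure_pmf.prob (spine_children d (plain_rate d p h)) (agree d c) * (real d * p * b)"
      unfolding spine by (simp add: Two' T_def)
    then show ?thesis by (simp add: Two' c1 del: reach_prob.simps)
  qed
  then show ?thesis by (simp add: C U_def u_def del: reach_prob.simps)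
qed

text \<open>The potentials at the parents of a generation, left over from the previous step, are exactly the
  factors that \<open>step_identity\<close> requires, and it replaces them by those of the next generation. At the
  root the potential is \<open>1\<close>.\<close>
lemma path_prob_gas_kernel:
  assumes d: "d \<ge> 1" and p: "0 \<le> p" "p < 1" and "m \<le> n"
  shows "path_prob d (gas_kernel d p n) m x =
    (\<Prod>v\<in>inner_verts d m. step_const d p (n - Suc (length v))) *
    of_bool (\<forall>v\<in>inner_verts d m. compatible d (root_state x v) (child_state x v)) *
    (\<Prod>e\<in>trunc_edges m d. edge_weight p (x e)) *
    (\<Prod>v\<in>level d m. potential d p (n - m) (root_state x v))"
  using \<open>m \<le> n\<close>
proof (induction m)
  case 0
  have "inner_verts d 0 = {}" "trunc_edges 0 d = {}" "level d 0 = {[]}"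
    by (auto simp: inner_verts_def trunc_edges_def tree_edges_def level_def tree_verts_def)
  then show ?case by (simp add: path_prob_def root_state_def)
next
  case (Suc m)
  let ?h = "n - Suc m"
  let ?C = "\<lambda>v :: nat list. step_const d p (n - Suc (length v))"
  let ?ok = "\<lambda>v. compatible d (root_state x v) (child_state x v)"
  have h: "n - m = Suc ?h" using Suc.prems by simp
  have local: "step_prob d (gas_kernel d p n) x v * potential d p (n - m) (root_state x v) =
      ?C v * of_bool (?ok v) *
      ((\<Prod>i<d. edge_weight p (x (v @ [i]))) * (\<Prod>i<d. potential d p ?h (root_state x (v @ [i]))))"
    if "v \<in> level d m" for v
    using step_identity[OF d p, of ?h "root_state x v" "child_state x v"] that h
    by (simp add: step_prob_def gas_kernel_def level_def child_state_def root_state_def prod.distrib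
        del: reach_prob.simps)
  have "path_prob d (gas_kernel d p n) (Suc m) x =
      (\<Prod>v\<in>inner_verts d m. ?C v) * of_bool (\<forall>v\<in>inner_verts d m. ?ok v) *
      (\<Prod>e\<in>trunc_edges m d. edge_weight p (x e)) *
      (\<Prod>v\<in>level d m. step_prob d (gas_kernel d p n) x v * potential d p (n - m) (root_state x v))"
    using Suc by (simp add: path_prob_Suc prod.distrib)
  also have "(\<Prod>v\<in>level d m. step_prob d (gas_kernel d p n) x v * potential d p (n - m) (root_state x v)) =
      (\<Prod>v\<in>level d m. ?C v * of_bool (?ok v) *
        ((\<Prod>i<d. edge_weight p (x (v @ [i]))) * (\<Prod>i<d. potential d p ?h (root_state x (v @ [i])))))"
    by (rule prod.cong[OF refl local])
  also have "\<dots> = (\<Prod>v\<in>level d m. ?C v) * of_bool (\<forall>v\<in>level d m. ?ok v) *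
      ((\<Prod>v\<in>level d m. \<Prod>i<d. edge_weight p (x (v @ [i]))) *
       (\<Prod>v\<in>level d m. \<Prod>i<d. potential d p ?h (root_state x (v @ [i]))))"
  proof -
    have "(\<Prod>v\<in>level d m. of_bool (?ok v) :: real) = of_bool (\<forall>v\<in>level d m. ?ok v)"
      by (auto intro!: prod.neutral prod_zero)
    then show ?thesis by (simp only: prod.distrib)
  qed
  finally show ?case
    unfolding prod_inner_verts_Suc prod_trunc_edges_Suc prod_level_Suc
    by (simp add: inner_verts_Suc ball_Un of_bool_conj mult_ac)
qed

definition chain_const :: "nat \<Rightarrow> real \<Rightarrow> nat \<Rightarrow> real" where
  "chain_const d p n = (\<Prod>v\<in>inner_verts d n. step_const d p (n - Suc (length v)))"

text \<open>At height \<open>0\<close> the potential vanishes at \<open>One'\<close> and is \<open>1\<close> otherwise, which is the boundary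
  condition of \<^const>\<open>consistent\<close>.\<close>
lemma path_prob_gas_kernel_full:
  assumes "d \<ge> 1" "0 \<le> p" "p < 1"
  shows "path_prob d (gas_kernel d p n) n x =
    chain_const d p n * of_bool (consistent d n x) * (\<Prod>e\<in>trunc_edges n d. edge_weight p (x e))"
proof -
  have "potential d p 0 s = of_bool (s \<noteq> One')" for s by (cases s) auto
  then have "(\<Prod>v\<in>level d n. potential d p 0 (root_state x v)) =
      of_bool (\<forall>v\<in>level d n. root_state x v \<noteq> One')"
    by (auto intro!: prod.neutral prod_zero)
  then show ?thesis
    using path_prob_gas_kernel[OF assms order.refl, of n x]
    by (simp add: chain_const_def consistent_def of_bool_conj mult_ac)
qed

definition open_config :: "'e set \<Rightarrow> ('e \<Rightarrow> state) \<Rightarrow> 'e \<Rightarrow> bool" where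
  "open_config F x = (\<lambda>e\<in>F. open_state (x e))"

lemma open_config_in_configs [simp]: "open_config F x \<in> configs F"
  by (simp add: open_config_def)

lemma prod_edge_weight:
  "(\<Prod>e\<in>trunc_edges n d. edge_weight p (x e)) =
    p ^ num_open (wired_tree n d) (\<lambda>e. open_state (x e)) *
    (1 - p) ^ num_closed (wired_tree n d) (\<lambda>e. open_state (x e))"
  by (simp add: edge_weight_def prod.If_cases finite_trunc_edges num_open_def num_closed_def
      wired_tree_def Int_def Collect_conj_eq[symmetric] conj_commute)

text \<open>A forest has exactly one consistent labelling and any other configuration has none, so the sum
  over labellings has at most one nonzero term.\<close>
lemma sum_path_prob_eq_gas_weight:
  assumes "d \<ge> 1" "0 \<le> p" "p < 1" and f: "f \<in> configs (trunc_edges n d)"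
  shows "(\<Sum>x | x \<in> configs (trunc_edges n d) \<and> open_config (trunc_edges n d) x = f.
      path_prob d (gas_kernel d p n) n x) = chain_const d p n * gas_weight (wired_tree n d) p f"
proof -
  let ?E = "trunc_edges n d"
  let ?X = "{x \<in> configs ?E. open_config ?E x = f}"
  have fin: "finite ?X"
    by (rule finite_subset[of _ "configs ?E"]) (auto simp: finite_configs finite_trunc_edges)
  have op: "open_state (x e) = f e" if "x \<in> ?X" "e \<in> ?E" for x e
    using that by (auto simp: open_config_def)
  have forest: "is_forest (wired_tree n d) f \<longleftrightarrow> is_forest (wired_tree n d) (\<lambda>e. open_state (x e))"
    if "x \<in> ?X" for x
    using op[OF that] by (intro is_forest_cong) (simp add: wired_tree_def)
  show ?thesis
  proof (cases "is_forest (wired_tree n d) f")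
    case True
    define x0 where "x0 = restrict (labelling d n f) ?E"
    have x0: "x0 \<in> ?X" using f
      by (auto simp: x0_def open_config_def configs_def PiE_iff fun_eq_iff restrict_def extensional_def)
    have cons: "consistent d n x0"
      using forest_imp_consistent_labelling[OF True]
      by (rule consistent_cong[THEN iffD2, rotated]) (simp add: x0_def)
    have "x = x0" if x: "x \<in> ?X" "consistent d n x" for x
    proof (rule extensionalityI[of _ ?E])
      show "x \<in> extensional ?E" "x0 \<in> extensional ?E"
        using x x0 by (auto simp: configs_def PiE_iff)
      show "x e = x0 e" if "e \<in> ?E" for e
        using x(2) cons _ that by (rule consistent_unique) (simp add: op[OF x(1)] op[OF x0])
    qed
    then have "(\<Sum>x\<in>?X. path_prob d (gas_kernel d p n) n x) =
        (\<Sum>x\<in>{x0}. path_prob d (gas_kernel d p n) n x)"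
      using x0 fin by (intro sum.mono_neutral_right) (auto simp: path_prob_gas_kernel_full[OF assms(1-3)])
    also have "\<dots> = chain_const d p n * gas_weight (wired_tree n d) p f"
    proof -
      have "{e \<in> ?E. open_state (x0 e)} = {e \<in> ?E. f e}" "{e \<in> ?E. \<not> open_state (x0 e)} = {e \<in> ?E. \<not> f e}"
        using op[OF x0] by auto
      then show ?thesis
        using True cons
        by (simp add: path_prob_gas_kernel_full[OF assms(1-3)] prod_edge_weight gas_weight_def
            num_open_def num_closed_def wired_tree_def)
    qed
    finally show ?thesis .
  next
    case False
    have "\<not> consistent d n x" if "x \<in> ?X" for x
      using False forest[OF that] consistent_imp_forest[of d n x] by blast
    then have "(\<Sum>x\<in>?X. path_prob d (gas_kernel d p n) n x) = 0"
      by (intro sum.neutral) (simp add: path_prob_gas_kernel_full[OF assms(1-3)])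
    then show ?thesis using False by (simp add: gas_weight_def)
  qed
qed

lemma measurable_open_config:
  assumes "F \<subseteq> I"
  shows "open_config F \<in> measurable (config_space I) (config_space F)"
proof -
  have "(\<lambda>x. open_state (x e)) \<in> measurable (config_space I) (count_space UNIV)" if "e \<in> F" for e
  proof -
    have "(\<lambda>x. x e) \<in> measurable (config_space I) (count_space (UNIV :: state set))"
      unfolding config_space_def using that assms by (intro measurable_component_singleton) auto
    then show ?thesis by (rule measurable_compose) simp
  qed
  then have "(\<lambda>x. \<lambda>e\<in>F. open_state (x e)) \<in> measurable (config_space I) (config_space F)"
    unfolding config_space_def[of F] by (rule measurable_restrict)
  then show ?thesis by (simp add: open_config_def[abs_def])
qed

text \<open>Both sides are probability measures whose point masses are proportional to the gas weights. Summing
  over all configurations identifies the constant as the inverse partition function.\<close>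
lemma arboreal_gas_eq_chain:
  assumes "d \<ge> 1" "0 \<le> p" "p < 1"
  shows "arboreal_gas (wired_tree n d) p =
    distr (joint_law (chain d (gas_kernel d p n)) (trunc_edges n d)) (config_space (trunc_edges n d))
      (open_config (trunc_edges n d))"
proof -
  let ?E = "trunc_edges n d"
  let ?L = "joint_law (chain d (gas_kernel d p n)) ?E"
  let ?w = "gas_weight (wired_tree n d) p"
  let ?C = "chain_const d p n"
  let ?Z = "\<Sum>g\<in>configs ?E. ?w g"
  interpret L: prob_space ?L by (rule prob_space_joint_law_chain[OF trunc_edges_subset])
  have setsL: "sets ?L = sets (config_space ?E)" by (simp add: joint_law_def)
  have spaceL: "space ?L = configs ?E"
    by (simp add: joint_law_def config_space_finite finite_trunc_edges)
  have meas: "open_config ?E \<in> measurable ?L (config_space ?E)"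
    unfolding measurable_cong_sets[OF setsL refl] by (rule measurable_open_config) simp
  have fin: "finite (configs ?E :: (nat list \<Rightarrow> bool) set)" "finite (configs ?E :: (nat list \<Rightarrow> state) set)"
    by (simp_all add: finite_configs finite_trunc_edges)
  have edges: "edges (wired_tree n d) = ?E" by (simp add: wired_tree_def)
  have single: "measure (distr ?L (config_space ?E) (open_config ?E)) {f} = ?C * ?w f"
    if f: "f \<in> configs ?E" for f
  proof -
    have "measure (distr ?L (config_space ?E) (open_config ?E)) {f} =
        measure ?L {x \<in> configs ?E. open_config ?E x = f}"
      using f by (subst measure_distr[OF meas])
        (auto simp: config_space_finite finite_trunc_edges spaceL intro!: arg_cong[where f = "measure ?L"])
    also have "\<dots> = ?C * ?w f"
      by (subst measure_joint_law_chain_sum) (auto simp: sum_path_prob_eq_gas_weight[OF assms f])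
    finally show ?thesis .
  qed
  have "(\<Sum>f\<in>configs ?E. ?C * ?w f) = (\<Sum>x\<in>configs ?E. path_prob d (gas_kernel d p n) n x)"
  proof -
    have "(\<Sum>f\<in>configs ?E. ?C * ?w f) = (\<Sum>f\<in>configs ?E. \<Sum>x | x \<in> configs ?E \<and> open_config ?E x = f.
        path_prob d (gas_kernel d p n) n x)"
      by (intro sum.cong refl) (simp add: sum_path_prob_eq_gas_weight[OF assms])
    also have "\<dots> = (\<Sum>x\<in>configs ?E. path_prob d (gas_kernel d p n) n x)"
      by (rule sum.group) (use fin in auto)
    finally show ?thesis .
  qed
  also have "\<dots> = measure ?L (space ?L)"
    by (simp add: spaceL measure_joint_law_chain_sum)
  finally have "?C * ?Z = 1" by (simp add: sum_distrib_left L.prob_space)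
  then have C: "?C = 1 / ?Z" by (metis div_by_0 mult_eq_0_iff nonzero_eq_divide_eq zero_neq_one)
  interpret D: prob_space "distr ?L (config_space ?E) (open_config ?E)"
    by (rule L.prob_space_distr[OF meas])
  show ?thesis
  proof (rule measure_eqI_finite[OF _ _ fin(1)])
    show "sets (arboreal_gas (wired_tree n d) p) = Pow (configs ?E)"
      by (simp add: arboreal_gas_def edges sets_point_measure)
    show "sets (distr ?L (config_space ?E) (open_config ?E)) = Pow (configs ?E)"
      by (simp add: config_space_finite finite_trunc_edges)
    fix f :: "nat list \<Rightarrow> bool" assume f: "f \<in> configs ?E"
    have "emeasure (arboreal_gas (wired_tree n d) p) {f} = ennreal (?w f / ?Z)"
      unfolding arboreal_gas_def edges using f fin(1) by (subst emeasure_point_measure_finite) auto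
    also have "\<dots> = emeasure (distr ?L (config_space ?E) (open_config ?E)) {f}"
      using single[OF f] by (simp add: D.emeasure_eq_measure C)
    finally show "emeasure (arboreal_gas (wired_tree n d) p) {f} = \<dots>" .
  qed
qed

lemma open_config_restrict: "F \<subseteq> E \<Longrightarrow> open_config F (restrict x E) = open_config F x"
  by (auto simp: open_config_def fun_eq_iff restrict_def)

lemma restrict_open_config: "F \<subseteq> E \<Longrightarrow> restrict (open_config E x) F = open_config F x"
  by (auto simp: open_config_def fun_eq_iff restrict_def)

lemma measurable_restrict_configs:
  "F \<subseteq> I \<Longrightarrow> (\<lambda>f. restrict f F) \<in> measurable (config_space I) (config_space F)"
  unfolding config_space_def by (rule measurable_restrict_subset)

lemma distr_joint_law_chain:
  assumes "F \<subseteq> E" "E \<subseteq> tree_edges d"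
  shows "distr (joint_law (chain d K) E) (config_space F) (open_config F) =
    distr (chain d K) (config_space F) (open_config F)"
  unfolding joint_law_def
  by (subst distr_distr[OF measurable_open_config[OF assms(1)] measurable_restrict_chain[OF assms(2)]])
     (simp add: comp_def open_config_restrict[OF assms(1)])

lemma joint_law_gas:
  assumes "d \<ge> 1" "0 \<le> p" "p < 1" and F: "F \<subseteq> trunc_edges n d"
  shows "joint_law (arboreal_gas (wired_tree n d) p) F =
    distr (chain d (gas_kernel d p n)) (config_space F) (open_config F)"
proof -
  let ?E = "trunc_edges n d"
  have "sets (joint_law (chain d (gas_kernel d p n)) ?E) = sets (config_space ?E)"
    by (simp add: joint_law_def)
  then have m: "open_config ?E \<in> measurable (joint_law (chain d (gas_kernel d p n)) ?E) (config_space ?E)"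
    using measurable_open_config[of ?E ?E] by (simp cong: measurable_cong_sets)
  show ?thesis
    unfolding arboreal_gas_eq_chain[OF assms(1-3)] joint_law_def[of _ F]
    by (subst distr_distr[OF measurable_restrict_configs[OF F] m])
       (simp add: comp_def restrict_open_config[OF F] distr_joint_law_chain[OF F trunc_edges_subset])
qed

lemma joint_law_project_law:
  assumes F: "F \<subseteq> tree_edges d"
  shows "joint_law (project_law d (chain d K)) F = distr (chain d K) (config_space F) (open_config F)"
proof -
  have m: "open_config (tree_edges d) \<in> measurable (chain d K) (config_space (tree_edges d))"
    unfolding measurable_cong_sets[OF sets_chain refl] by (rule measurable_open_config) simp
  show ?thesis
    unfolding joint_law_def project_law_def open_config_def[symmetric]
    by (subst distr_distr[OF measurable_restrict_configs[OF F] m])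
       (simp add: comp_def restrict_open_config[OF F])
qed

text \<open>Reduces events that depend on finitely many edges to finite sums of path probabilities over a
  number \<open>m\<close> of generations that is the same for all kernels, which allows passing to the limit
  term by term.\<close>
lemma measure_distr_chain:
  assumes F: "F \<subseteq> trunc_edges m d" and A: "A \<in> sets (config_space F)"
  shows "measure (distr (chain d K) (config_space F) (open_config F)) A =
    (\<Sum>x | x \<in> configs (trunc_edges m d) \<and> open_config F x \<in> A. path_prob d K m x)"
proof -
  let ?L = "joint_law (chain d K) (trunc_edges m d)"
  have setsL: "sets ?L = sets (config_space (trunc_edges m d))" by (simp add: joint_law_def)
  have meas: "open_config F \<in> measurable ?L (config_space F)"
    unfolding measurable_cong_sets[OF setsL refl] by (rule measurable_open_config[OF F])
  have "measure (distr (chain d K) (config_space F) (open_config F)) A =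
      measure ?L (open_config F -` A \<inter> space ?L)"
    unfolding distr_joint_law_chain[OF F trunc_edges_subset, symmetric] by (rule measure_distr[OF meas A])
  also have "open_config F -` A \<inter> space ?L = {x \<in> configs (trunc_edges m d). open_config F x \<in> A}"
    by (auto simp: joint_law_def config_space_finite finite_trunc_edges)
  also have "measure ?L \<dots> = (\<Sum>x | x \<in> configs (trunc_edges m d) \<and> open_config F x \<in> A. path_prob d K m x)"
    by (rule measure_joint_law_chain_sum) auto
  finally show ?thesis .
qed

section \<open>Convergence of the transition parameters\<close>

text \<open>The recursion applies an increasing function, and its first step goes down from \<open>1\<close>.\<close>
lemma reach_prob_antimono:
  assumes "d \<ge> 1" "0 \<le> p" "p < 1"
  shows "reach_prob d p (Suc h) \<le> reach_prob d p h"
proof -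
  let ?phi = "\<lambda>s. real d * p * s / (1 + (real d - 1) * p * s)"
  have pos: "1 + (real d - 1) * p * s > 0" if "0 \<le> s" for s
    using assms that by (intro add_pos_nonneg) auto
  have mono: "?phi s \<le> ?phi t" if st: "0 \<le> s" "s \<le> t" for s t
  proof -
    have "real d * p * s \<le> real d * p * t" using st assms by (intro mult_left_mono) auto
    then have "real d * p * s * (1 + (real d - 1) * p * t) \<le> real d * p * t * (1 + (real d - 1) * p * s)"
      by (simp add: algebra_simps)
    then show ?thesis using pos[of s] pos[of t] st by (simp add: frac_le_eq divide_simps mult_ac)
  qed
  show ?thesis
  proof (induction h)
    case 0
    show ?case using reach_prob_range(2)[OF assms, of "Suc 0"] by simp
  next
    case (Suc h)
    then show ?case using mono[OF reach_prob_range(1)[OF assms] Suc] by simp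
  qed
qed

text \<open>The decreasing sequence converges to a fixed point \<open>L \<ge> 0\<close> of the recursion, that is, \<open>L = 0\<close> or
  \<open>(d - 1) p L = d p - 1\<close>. For \<open>d p > 1\<close> the second solution is \<open>\<theta> > 0\<close>, and the sequence stays above
  it because the recursion is monotone; for \<open>d p \<le> 1\<close> no positive solution exists.\<close>
lemma reach_prob_tendsto:
  assumes d: "d \<ge> 2" and p: "0 \<le> p" "p < 1"
    and \<theta>: "\<theta> = (if p > 1 / real d then (real d * p - 1) / (p * (real d - 1)) else 0)"
  shows "reach_prob d p \<longlonglongrightarrow> \<theta>"
proof -
  have d1: "d \<ge> 1" using d by simp
  note range = reach_prob_range[OF d1 p]
  have "decseq (reach_prob d p)" using reach_prob_antimono[OF d1 p] by (intro decseq_SucI) auto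
  then obtain L where L: "reach_prob d p \<longlonglongrightarrow> L"
    using decseq_convergent[of "reach_prob d p" 0] range(1) by metis
  have L0: "0 \<le> L" using LIMSEQ_le_const[OF L, of 0] range(1) by blast
  have pos: "1 + (real d - 1) * p * L > 0" using d p L0 by (intro add_pos_nonneg) auto
  have "(\<lambda>h. reach_prob d p (Suc h)) \<longlonglongrightarrow> real d * p * L / (1 + (real d - 1) * p * L)"
    unfolding reach_prob.simps using pos by (intro tendsto_intros L) auto
  then have "L = real d * p * L / (1 + (real d - 1) * p * L)"
    using LIMSEQ_Suc[OF L] LIMSEQ_unique by blast
  then have "L * (1 + (real d - 1) * p * L) = real d * p * L" using pos by (simp add: field_simps)
  then have "L * (1 + (real d - 1) * p * L - real d * p) = 0" by (simp add: algebra_simps)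
  then have fixpoint: "L = 0 \<or> (real d - 1) * p * L = real d * p - 1" by auto
  show ?thesis
  proof (cases "p > 1 / real d")
    case True
    then have dp: "real d * p > 1" using d by (simp add: field_simps)
    then have p0: "p > 0" using p by (cases "p = 0") auto
    have den: "p * (real d - 1) > 0" using d p0 by simp
    have eq: "\<theta> = (real d * p - 1) / (p * (real d - 1))" using True by (simp add: \<theta>)
    have th: "\<theta> > 0" using den dp unfolding eq by (intro divide_pos_pos) auto
    have th2: "(real d - 1) * p * \<theta> = real d * p - 1"
      using den unfolding eq by (metis less_irrefl mult.commute nonzero_mult_div_cancel_left times_divide_eq_right)
    have "\<theta> \<le> reach_prob d p h" for h
    proof (induction h)
      case 0
      have "real d * p - 1 \<le> p * (real d - 1)" using p by (simp add: algebra_simps)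
      then show ?case using den True by (simp add: \<theta> divide_le_eq)
    next
      case (Suc h)
      let ?s = "reach_prob d p h"
      have D: "1 + (real d - 1) * p * ?s > 0" using d p range(1)[of h] by (intro add_pos_nonneg) auto
      have "\<theta> * (1 + (real d - 1) * p * ?s) = \<theta> + ((real d - 1) * p * \<theta>) * ?s"
        by (simp add: algebra_simps)
      also have "\<dots> = \<theta> + (real d * p - 1) * ?s" by (simp only: th2)
      also have "\<dots> \<le> real d * p * ?s" using Suc by (simp add: algebra_simps)
      finally show ?case using D by (simp add: le_divide_eq)
    qed
    then have "\<theta> \<le> L" using LIMSEQ_le_const[OF L] by blast
    then have "(real d - 1) * p * L = (real d - 1) * p * \<theta>" using fixpoint th th2 by auto
    then have "L = \<theta>" using den by auto
    then show ?thesis using L by simp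
  next
    case False
    then have dp: "real d * p \<le> 1" using d by (simp add: field_simps)
    have "L = 0"
    proof (rule ccontr)
      assume "L \<noteq> 0"
      then have eq: "(real d - 1) * p * L = real d * p - 1" "L > 0" using fixpoint L0 by auto
      then have "(real d - 1) * p * L \<le> 0" using dp by simp
      then have "p = 0" using eq(2) d p by (simp add: mult_le_0_iff)
      then show False using eq by simp
    qed
    then show ?thesis using L False by (simp add: \<theta>)
  qed
qed

lemma plain_rate_tendsto:
  assumes d: "d \<ge> 2" and p: "0 \<le> p" "p < 1"
    and \<theta>: "\<theta> = (if p > 1 / real d then (real d * p - 1) / (p * (real d - 1)) else 0)"
    and \<alpha>: "\<alpha> = (if p > 1 / real d then 1 / real d else p)"
  shows "plain_rate d p \<longlonglongrightarrow> \<alpha>"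
proof -
  have d1: "d \<ge> 1" using d by simp
  have lim: "reach_prob d p \<longlonglongrightarrow> \<theta>" by (rule reach_prob_tendsto[OF d p \<theta>])
  have "\<theta> \<le> 1" using LIMSEQ_le_const2[OF lim] reach_prob_range[OF d1 p] by blast
  then have "p * \<theta> \<le> p" using p mult_left_mono[of \<theta> 1 p] by simp
  then have ne: "1 - p * \<theta> \<noteq> 0" using p by simp
  have "plain_rate d p \<longlonglongrightarrow> p * (1 - \<theta>) / (1 - p * \<theta>)"
    unfolding plain_rate_def using ne by (intro tendsto_intros lim) auto
  moreover have "p * (1 - \<theta>) / (1 - p * \<theta>) = \<alpha>"
  proof (cases "p > 1 / real d")
    case True
    then have "p > 0" using d by (smt (verit) divide_nonneg_nonneg of_nat_0_le_iff)
    then have pt: "p * \<theta> = (real d * p - 1) / (real d - 1)" using True d by (simp add: \<theta>)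
    have "p * (1 - \<theta>) = (1 - p) / (real d - 1)" "1 - p * \<theta> = real d * ((1 - p) / (real d - 1))"
      unfolding right_diff_distrib pt using d by (simp_all add: field_simps)
    then show ?thesis using True p d by (simp add: \<alpha>)
  next
    case False
    then show ?thesis by (simp add: \<theta> \<alpha>)
  qed
  ultimately show ?thesis by simp
qed

text \<open>The parameters are constrained to the unit interval since \<^const>\<open>bernoulli_pmf\<close> truncates them
  there; inside it the probabilities are polynomials in the parameters.\<close>
lemma prob_children_law_tendsto:
  assumes d: "d \<ge> 1"
    and t: "t \<longlonglongrightarrow> \<theta>" "\<And>n. 0 \<le> t n" "\<And>n. t n \<le> 1"
    and a: "a \<longlonglongrightarrow> \<alpha>" "\<And>n. 0 \<le> a n" "\<And>n. a n \<le> 1"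
  shows "(\<lambda>n. measure_pmf.prob (children_law d (t n) (a n) s) (agree d c)) \<longlonglongrightarrow>
    measure_pmf.prob (children_law d \<theta> \<alpha> s) (agree d c)"
proof -
  have \<theta>: "0 \<le> \<theta>" "\<theta> \<le> 1"
    using t LIMSEQ_le_const[OF t(1)] LIMSEQ_le_const2[OF t(1)] by blast+
  have \<alpha>: "0 \<le> \<alpha>" "\<alpha> \<le> 1"
    using a LIMSEQ_le_const[OF a(1)] LIMSEQ_le_const2[OF a(1)] by blast+
  have state: "(\<lambda>n. pmf (plain_state (a n)) s') \<longlonglongrightarrow> pmf (plain_state \<alpha>) s'" for s'
    using \<alpha> a by (cases s') (auto simp: pmf_plain_state intro!: tendsto_intros)
  have plain: "(\<lambda>n. measure_pmf.prob (plain_children d (a n)) (agree d c)) \<longlonglongrightarrow>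
      measure_pmf.prob (plain_children d \<alpha>) (agree d c)"
    unfolding prob_plain_children by (intro tendsto_intros state)
  have spine: "(\<lambda>n. measure_pmf.prob (spine_children d (a n)) (agree d c)) \<longlonglongrightarrow>
      measure_pmf.prob (spine_children d \<alpha>) (agree d c)"
    unfolding prob_spine_children[OF d] using d by (intro tendsto_intros) (auto intro: state)
  show ?thesis
  proof (cases s)
    case Zero'
    show ?thesis
      unfolding Zero' prob_children_law_Zero[OF \<theta>] prob_children_law_Zero[OF t(2,3)]
      by (intro tendsto_intros t(1) plain spine)
  qed (use plain spine in simp_all)
qed

text \<open>The generation \<open>k\<close> is fixed while the subtree height \<open>n - k\<close> grows, so every kernel in the finite
  product tends to the homogeneous one.\<close>
lemma path_prob_gas_kernel_tendsto:
  assumes d: "d \<ge> 2" and p: "0 \<le> p" "p < 1"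
    and \<theta>: "\<theta> = (if p > 1 / real d then (real d * p - 1) / (p * (real d - 1)) else 0)"
    and \<alpha>: "\<alpha> = (if p > 1 / real d then 1 / real d else p)"
  shows "(\<lambda>n. path_prob d (gas_kernel d p n) m x) \<longlonglongrightarrow> path_prob d (\<lambda>_. children_law d \<theta> \<alpha>) m x"
proof -
  have d1: "d \<ge> 1" using d by simp
  have shift: "filterlim (\<lambda>n. n - k) at_top at_top" for k :: nat
    by (rule filterlim_minus_const_nat_at_top)
  show ?thesis
    unfolding path_prob_def step_prob_def gas_kernel_def
    by (intro tendsto_prod prob_children_law_tendsto d1 reach_prob_range[OF d1 p] plain_rate_range[OF d1 p]
        filterlim_compose[OF reach_prob_tendsto[OF d p \<theta>] shift]
        filterlim_compose[OF plain_rate_tendsto[OF d p \<theta> \<alpha>] shift])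
qed

lemma finite_subset_trunc_edges:
  assumes "finite F" "F \<subseteq> tree_edges d"
  obtains m where "F \<subseteq> trunc_edges m d"
proof
  show "F \<subseteq> trunc_edges (Max (insert 0 (length ` F))) d"
    using assms by (auto simp: trunc_edges_def intro!: Max_ge)
qed

section \<open>The weak limit\<close>

theorem theorem1p1:
  fixes d :: nat and p \<theta> \<alpha> :: real
  assumes "d \<ge> 2" and "0 \<le> p" and "p < 1"
    and "\<theta> = (if p > 1 / real d then (real d * p - 1) / (p * (real d - 1)) else 0)"
    and "\<alpha> = (if p > 1 / real d then 1 / real d else p)"
  shows "\<exists>P Q.
           prob_space P \<and> sets P = sets (config_space (tree_edges d)) \<and>
           converges_weakly (tree_edges d) (\<lambda>n. arboreal_gas (wired_tree n d) p) P \<and>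
           is_tree_markov_law d \<theta> \<alpha> Q \<and>
           P = project_law d Q"
proof -
  have d: "d \<ge> 1" using assms(1) by simp
  define K where "K = (\<lambda>_ :: nat. children_law d \<theta> \<alpha>)"
  define Q where "Q = chain d K"
  have "open_config (tree_edges d) \<in> measurable Q (config_space (tree_edges d))"
    unfolding Q_def measurable_cong_sets[OF sets_chain refl] by (rule measurable_open_config) simp
  then have "prob_space (project_law d Q)"
    unfolding project_law_def open_config_def[symmetric] Q_def
    by (rule prob_space.prob_space_distr[OF prob_space_chain])
  moreover have "converges_weakly (tree_edges d) (\<lambda>n. arboreal_gas (wired_tree n d) p) (project_law d Q)"
    unfolding converges_weakly_def
  proof (intro allI impI ballI)
    fix F A assume F: "finite F \<and> F \<subseteq> tree_edges d"
      and A: "A \<in> sets (config_space F :: (nat list \<Rightarrow> bool) measure)"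
    then obtain m where m: "F \<subseteq> trunc_edges m d" using finite_subset_trunc_edges by metis
    let ?X = "{x \<in> configs (trunc_edges m d). open_config F x \<in> A}"
    have gas: "measure (joint_law (arboreal_gas (wired_tree n d) p) F) A =
        (\<Sum>x\<in>?X. path_prob d (gas_kernel d p n) m x)" if "m \<le> n" for n
    proof -
      have "F \<subseteq> trunc_edges n d" using m trunc_edges_mono[OF that] by (rule order_trans)
      then show ?thesis by (simp add: joint_law_gas[OF d assms(2,3)] measure_distr_chain[OF m A])
    qed
    have "(\<lambda>n. \<Sum>x\<in>?X. path_prob d (gas_kernel d p n) m x) \<longlonglongrightarrow> (\<Sum>x\<in>?X. path_prob d K m x)"
      unfolding K_def by (intro tendsto_sum path_prob_gas_kernel_tendsto assms)
    also have "(\<Sum>x\<in>?X. path_prob d K m x) = measure (joint_law (project_law d Q) F) A"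
      using F by (simp add: Q_def joint_law_project_law measure_distr_chain[OF m A])
    finally show "(\<lambda>n. measure (joint_law (arboreal_gas (wired_tree n d) p) F) A)
        \<longlonglongrightarrow> measure (joint_law (project_law d Q) F) A"
      by (rule Lim_transform_eventually)
         (use gas in \<open>auto intro!: eventually_mono[OF eventually_ge_at_top[of m]]\<close>)
  qed
  moreover have "is_tree_markov_law d \<theta> \<alpha> Q"
    unfolding Q_def K_def by (rule chain_is_tree_markov_law)
  moreover have "sets (project_law d Q) = sets (config_space (tree_edges d))"
    by (simp add: project_law_def)
  ultimately show ?thesis by blast
qed

end
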